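(* Let $\Gamma=(V,E)$ be a weighted strongly-connected digraph and let $\mathcal{G}$ be its normalized Green's function. Then $$\mathrm{Tr}(\mathcal{G})=\frac{1}{\sum_{w\in V} d_w\tau_w}\sum_{T_1\cup T_2\in\mathbb{F}^*_2}d_{r(T_1)}\,d_{r(T_2)}\,\omega(T_1\cup T_2).$$
   Context: A weighted digraph $\Gamma=(V,E)$ is finite with at least two vertices, has no loops, and has at most one edge $(u,v)$ for each ordered pair of distinct vertices; each edge $e=(u,v)\in E$ has a weight $\omega(e)=\omega(u,v)>0$, and $\omega(u,v)=0$ if $(u,v)\notin E$. The adjacency matrix is $A(u,v)=\omega(u,v)$, the (out-)degree is $d_u=\sum_v\omega(u,v)$, $D=\mathrm{Diag}[d_u]$, and $P=D^{-1}A$ is the transition probability matrix. For strongly-connected $\Gamma$, the stationary distribution $(\pi_u)_{u\in V}$ is the unique vector with $\pi_u>0$ for all $u$, $\sum_u\pi_u=1$ and $\pi^{T}P=\pi^{T}$; $\Pi=\mathrm{Diag}[\pi_u]$. The normalized Laplacian is $\mathcal{L}=\Pi^{1/2}(I-P)\Pi^{-1/2}$, and the normalized Green's function $\mathcal{G}$ is the Moore–Penrose pseudoinverse of $\mathcal{L}$. A rooted $k$-forest is a digraph whose underlying undirected graph is a forest with $k$ connected components (no cycles; in particular it does not contain both $(u,v)$ and $(v,u)$) and such that each weakly-connected component has a vertex, its root, to which every vertex of that component has a unique directed path. A subdigraph of $\Gamma$ is spanning if it contains all vertices of $\Gamma$. $\mathbb{F}^*_k$ denotes the set of spanning rooted $k$-forests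 of $\Gamma$. An element of $\mathbb{F}^*_2$ is written $T_1\cup T_2$, where $T_1,T_2$ are its two components (unordered; each forest is counted once in the sum), with roots $r(T_1),r(T_2)$. The weight of a forest is $\omega(F)=\prod_{e\in E(F)}\omega(e)$, and $\tau_w=\sum_{T\in\mathbb{F}^*_1,\ r(T)=w}\omega(T)$ is the total weight of the rooted spanning trees with root $w$. *)

theory Defs
  imports "HOL-Analysis.Analysis" "Graph_Theory.Graph_Theory"
begin

section \<open>Weighted digraphs and their matrices\<close>

text \<open>
  The vertex set is the whole of an arbitrary finite type, so that vectors and matrices indexed by
  the vertices are the ones of HOL-Analysis. The locale \<open>pair_digraph\<close> provides finiteness,
  absence of loops, and at most one arc for each ordered pair of vertices.
\<close>

locale weighted_digraph = pair_digraph \<Gamma>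
  for \<Gamma> :: "'v::finite pair_pre_digraph" +
  fixes \<omega> :: "'v \<times> 'v \<Rightarrow> real"
  assumes pverts_eq_UNIV: "pverts \<Gamma> = UNIV"
    and at_least_two_vertices: "2 \<le> CARD('v)"
    and weight_pos: "e \<in> parcs \<Gamma> \<Longrightarrow> \<omega> e > 0"
    and weight_zero: "e \<notin> parcs \<Gamma> \<Longrightarrow> \<omega> e = 0"

definition diag_matrix :: "('v \<Rightarrow> real) \<Rightarrow> real^'v^'v" where
  "diag_matrix f = (\<chi> i j. if i = j then f i else 0)"

definition adjacency_matrix :: "('v \<times> 'v \<Rightarrow> real) \<Rightarrow> real^'v^'v" where
  "adjacency_matrix \<omega> = (\<chi> u v. \<omega> (u, v))"

definition out_weight :: "('v::finite \<times> 'v \<Rightarrow> real) \<Rightarrow> 'v \<Rightarrow> real" where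
  "out_weight \<omega> u = (\<Sum>v\<in>UNIV. \<omega> (u, v))"

definition transition_matrix :: "('v::finite \<times> 'v \<Rightarrow> real) \<Rightarrow> real^'v^'v" where
  "transition_matrix \<omega> = matrix_inv (diag_matrix (out_weight \<omega>)) ** adjacency_matrix \<omega>"

definition is_stationary_distribution :: "real^'v^'v \<Rightarrow> real^'v \<Rightarrow> bool" where
  "is_stationary_distribution P p \<longleftrightarrow>
     (\<forall>u. p $ u > 0) \<and> (\<Sum>u\<in>UNIV. p $ u) = 1 \<and> p v* P = p"

definition stationary_distribution :: "('v::finite \<times> 'v \<Rightarrow> real) \<Rightarrow> real^'v" where
  "stationary_distribution \<omega> = (THE p. is_stationary_distribution (transition_matrix \<omega>) p)"

definition sqrt_stationary_matrix :: "('v::finite \<times> 'v \<Rightarrow> real) \<Rightarrow> real^'v^'v" where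
  "sqrt_stationary_matrix \<omega> = diag_matrix (\<lambda>u. sqrt (stationary_distribution \<omega> $ u))"

definition normalized_laplacian :: "('v::finite \<times> 'v \<Rightarrow> real) \<Rightarrow> real^'v^'v" where
  "normalized_laplacian \<omega> =
     sqrt_stationary_matrix \<omega> ** (mat 1 - transition_matrix \<omega>)
       ** matrix_inv (sqrt_stationary_matrix \<omega>)"

text \<open>The four Penrose conditions; over the reals the conjugate transpose is the transpose.\<close>

definition is_moore_penrose_inverse :: "real^'n^'m \<Rightarrow> real^'m^'n \<Rightarrow> bool" where
  "is_moore_penrose_inverse A X \<longleftrightarrow>
     A ** X ** A = A \<and> X ** A ** X = X \<and>
     transpose (A ** X) = A ** X \<and> transpose (X ** A) = X ** A"

definition moore_penrose_inverse :: "real^'n^'m \<Rightarrow> real^'m^'n" where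
  "moore_penrose_inverse A = (THE X. is_moore_penrose_inverse A X)"

definition normalized_green :: "('v::finite \<times> 'v \<Rightarrow> real) \<Rightarrow> real^'v^'v" where
  "normalized_green \<omega> = moore_penrose_inverse (normalized_laplacian \<omega>)"

section \<open>Rooted forests\<close>

text \<open>
  \<open>forest\<close> and \<open>tree\<close> of Graph_Theory only exclude directed cycles, so they do not express that
  the underlying undirected graph is acyclic. In \<open>mk_symmetric F\<close> an undirected edge is a
  pair of opposite arcs; walking one edge back and forth is a cycle of length 2 there, hence
  undirected cycles are the cycles of length at least 3. The pair of opposite arcs
  in \<open>F\<close> itself, which is an undirected cycle of length 2, is excluded separately (taking
  \<open>u = v\<close>, so are loops).
\<close>

definition undirected_acyclic :: "'a pair_pre_digraph \<Rightarrow> bool" where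
  "undirected_acyclic F \<longleftrightarrow>
     (\<forall>u v. (u, v) \<in> parcs F \<longrightarrow> (v, u) \<notin> parcs F) \<and>
     (\<nexists>c. pre_digraph.cycle (with_proj (mk_symmetric (with_proj F))) c \<and> 3 \<le> length c)"

text \<open>
  \<open>Digraph_Component.connected\<close> is weak connectivity (strong connectivity of the symmetrization);
  the qualifier is needed because HOL-Analysis also has a topological \<open>connected\<close>.
\<close>

definition weak_components :: "'a pair_pre_digraph \<Rightarrow> 'a pair_pre_digraph set" where
  "weak_components F =
     {T. pre_digraph.max_subgraph (with_proj F) Digraph_Component.connected (with_proj T)}"

definition is_root :: "'a pair_pre_digraph \<Rightarrow> 'a \<Rightarrow> bool" where
  "is_root T r \<longleftrightarrow>
     r \<in> pverts T \<and> (\<forall>v\<in>pverts T. \<exists>!p. pre_digraph.apath (with_proj T) v p r)"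

definition root_of :: "'a pair_pre_digraph \<Rightarrow> 'a" where
  "root_of T = (THE r. is_root T r)"

definition rooted_forest :: "nat \<Rightarrow> 'a pair_pre_digraph \<Rightarrow> bool" where
  "rooted_forest k F \<longleftrightarrow>
     pair_digraph F \<and> undirected_acyclic F \<and> card (weak_components F) = k \<and>
     (\<forall>T\<in>weak_components F. \<exists>r. is_root T r)"

definition spanning_rooted_forests ::
  "'a pair_pre_digraph \<Rightarrow> nat \<Rightarrow> 'a pair_pre_digraph set" where
  "spanning_rooted_forests \<Gamma> k =
     {F. spanning (with_proj F) (with_proj \<Gamma>) \<and> rooted_forest k F}"

definition forest_weight :: "('a \<times> 'a \<Rightarrow> real) \<Rightarrow> 'a pair_pre_digraph \<Rightarrow> real" where
  "forest_weight \<omega> F = (\<Prod>e\<in>parcs F. \<omega> e)"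

definition rooted_tree_weight ::
  "'a pair_pre_digraph \<Rightarrow> ('a \<times> 'a \<Rightarrow> real) \<Rightarrow> 'a \<Rightarrow> real" where
  "rooted_tree_weight \<Gamma> \<omega> w =
     (\<Sum>T | T \<in> spanning_rooted_forests \<Gamma> 1 \<and> root_of T = w. forest_weight \<omega> T)"

end

theory Submission
  imports Defs
begin

text \<open>
  Write \<open>N\<close> for the normalized Laplacian and \<open>\<phi>\<close> for the unit vector with entries \<open>sqrt (\<pi> u)\<close>.
  Both \<open>N *v \<phi> = 0\<close> and \<open>\<phi> v* N = 0\<close>, and by irreducibility the kernel of \<open>N\<close> is the line through
  \<open>\<phi>\<close>. With the orthogonal projection \<open>J\<close> onto that line, \<open>N + J\<close> is therefore invertible and the
  pseudoinverse is \<open>matrix_inv (N + J) - J\<close>. Formally, the eigenvalue 0 of \<open>N\<close> has been moved to 1,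
  so \<open>x * det (x + N + J) = (x + 1) * det (x + N)\<close>; comparing the derivatives at \<open>x = 0\<close> shows that
  the trace of the pseudoinverse is the quotient of the coefficients of \<open>x\<^sup>2\<close> and of \<open>x\<close> in
  \<open>det (x + N)\<close> (\<open>trace_moore_penrose_inverse_common_kernel\<close>).

  It remains to identify these coefficients. Since \<open>x + N\<close> is similar to \<open>x + 1 - P\<close>, its
  determinant is that of \<open>x D + D - A\<close> divided by the product of the degrees. Row \<open>u\<close> of
  \<open>x D + D - A\<close> is \<open>x d\<^sub>u e\<^sub>u\<close> plus the sum of the vectors \<open>\<omega>(u, z) (e\<^sub>u - e\<^sub>z)\<close>, and expanding the
  determinant along all rows at once amounts to choosing for each vertex \<open>u\<close> either itself or one
  successor, that is, a function \<open>f\<close> on the vertices whose fixed points are the vertices that chose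
  themselves. The matrix of such a choice has determinant 1 if every vertex runs into a fixed
  point under iteration of \<open>f\<close>, and 0 otherwise (\<open>matrix_forest_theorem\<close>).

  Functions of the first kind that only use arcs of the digraph are exactly the spanning rooted
  forests: an arc leads from each
  non-root to its value, the fixed points are the roots, and each weak component consists of the
  vertices that run into one given root (\<open>spanning_rooted_forests_eq\<close>,
  \<open>weak_components_successor_graph\<close>). Hence the coefficient of \<open>x\<^sup>k\<close> in \<open>det (x D + D - A)\<close> is the
  sum over the \<open>k\<close>-forests of the forest weight times the degrees of the roots.
\<close>

section \<open>Inverses and diagonal matrices\<close>

lemma matrix_inv_unique:
  fixes A B :: "real^'n^'n"
  assumes "A ** B = mat 1"
  shows "matrix_inv A = B"
proof -
  have BA: "B ** A = mat 1"
    using assms matrix_left_right_inverse by blast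
  have "A ** matrix_inv A = mat 1 \<and> matrix_inv A ** A = mat 1"
    unfolding matrix_inv_def by (rule someI[of _ B]) (use assms BA in auto)
  then have "B ** (A ** matrix_inv A) = B"
    by simp
  then show ?thesis
    by (simp add: matrix_mul_assoc BA)
qed

lemma matrix_inv_mult:
  fixes A :: "real^'n^'n"
  assumes "invertible A"
  shows "A ** matrix_inv A = mat 1" "matrix_inv A ** A = mat 1"
proof -
  obtain B where "A ** B = mat 1" "B ** A = mat 1"
    using assms invertible_def by blast
  then show "A ** matrix_inv A = mat 1" "matrix_inv A ** A = mat 1"
    using matrix_inv_unique by auto
qed

lemma diag_matrix_mult_left: "(diag_matrix f ** A) $ i $ j = f i * A $ i $ j"
  by (simp add: diag_matrix_def matrix_matrix_mult_def if_distrib[of "\<lambda>x. x * _"] sum.delta cong: if_cong)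

lemma diag_matrix_mult_right: "(A ** diag_matrix f) $ i $ j = A $ i $ j * f j"
  by (simp add: diag_matrix_def matrix_matrix_mult_def if_distrib[of "\<lambda>x. _ * x"] sum.delta' cong: if_cong)

lemma matrix_inv_diag_matrix:
  assumes "\<And>i. f i \<noteq> 0"
  shows "matrix_inv (diag_matrix f) = diag_matrix (\<lambda>i. 1 / f i)"
proof (rule matrix_inv_unique)
  show "diag_matrix f ** diag_matrix (\<lambda>i. 1 / f i) = mat 1"
    using assms by (simp add: vec_eq_iff diag_matrix_mult_left) (simp add: diag_matrix_def mat_def)
qed

lemma diag_matrix_one: "diag_matrix (\<lambda>i. 1) = mat 1"
  by (simp add: diag_matrix_def mat_def vec_eq_iff)

lemma diag_matrix_mult: "diag_matrix f ** diag_matrix g = diag_matrix (\<lambda>i. f i * g i)"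
  by (simp add: vec_eq_iff diag_matrix_mult_left) (simp add: diag_matrix_def)

lemma det_diag_matrix: "det (diag_matrix f) = (\<Prod>i\<in>UNIV. f i)"
  by (subst det_diagonal) (simp_all add: diag_matrix_def)

section \<open>The matrix forest theorem\<close>

text \<open>
  A function on the vertices encodes a choice of at most one outgoing arc per vertex: \<open>f
  u = u\<close> means that no arc leaves \<open>u\<close>, which is unambiguous because the
  digraphs have no loops. The condition below is that following the arcs always stops.
\<close>
definition eventually_fixed :: "('v \<Rightarrow> 'v) \<Rightarrow> bool" where
  "eventually_fixed f \<longleftrightarrow> (\<forall>v. \<exists>k. f ((f ^^ k) v) = (f ^^ k) v)"

text \<open>
  The Laplacian of the functional digraph of \<open>f\<close>, with the zero rows of the sinks
  replaced by unit vectors.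
\<close>
definition successor_matrix :: "('v::finite \<Rightarrow> 'v) \<Rightarrow> real^'v^'v" where
  "successor_matrix f = (\<chi> u. if f u = u then axis u 1 else axis u 1 - axis (f u) 1)"

text \<open>
  Only the identity contributes to the Leibniz expansion: a permutation that moves a point and
  has a nonzero term must follow \<open>f\<close> along the whole orbit of that point, which
  would then never reach a fixed point of \<open>f\<close>.
\<close>
lemma det_successor_matrix_eventually_fixed:
  fixes f :: "'v::finite \<Rightarrow> 'v"
  assumes "eventually_fixed f"
  shows "det (successor_matrix f) = 1"
proof -
  let ?N = "successor_matrix f"
  have only_id: "(\<Prod>i\<in>UNIV. ?N $ i $ p i) = 0" if perm: "p permutes UNIV" and "p \<noteq> id" for p
  proof (rule ccontr)
    assume nz: "(\<Prod>i\<in>UNIV. ?N $ i $ p i) \<noteq> 0"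
    have moved: "p i = f i" if "p i \<noteq> i" for i
    proof -
      have "?N $ i $ p i \<noteq> 0"
        using nz by (metis (no_types, lifting) UNIV_I finite prod_zero_iff)
      then show ?thesis
        using that by (auto simp: successor_matrix_def axis_def split: if_splits)
    qed
    obtain i where i: "p i \<noteq> i"
      using \<open>p \<noteq> id\<close> by (metis eq_id_iff)
    have inj: "inj p"
      using perm by (rule permutes_inj)
    have iter: "(f ^^ k) i = (p ^^ k) i \<and> p ((p ^^ k) i) \<noteq> (p ^^ k) i" for k
    proof (induction k)
      case 0
      then show ?case using i by simp
    next
      case (Suc k)
      then have "f ((f ^^ k) i) = p ((p ^^ k) i)"
        using moved[of "(p ^^ k) i"] by metis
      moreover have "p (p ((p ^^ k) i)) \<noteq> p ((p ^^ k) i)"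
        using Suc inj by (metis injD)
      ultimately show ?case
        by simp
    qed
    obtain k where "f ((f ^^ k) i) = (f ^^ k) i"
      using assms by (auto simp: eventually_fixed_def)
    then show False
      using iter[of k] moved[of "(p ^^ k) i"] by simp
  qed
  have diag: "?N $ i $ i = 1" for i
    by (simp add: successor_matrix_def axis_def)
  have "det ?N = (\<Sum>p\<in>{p :: 'v \<Rightarrow> 'v. p permutes UNIV}. if p = id then 1 else 0)"
    unfolding det_def
  proof (intro sum.cong refl)
    fix p :: "'v \<Rightarrow> 'v"
    assume "p \<in> {p. p permutes UNIV}"
    then show "of_int (sign p) * (\<Prod>i\<in>UNIV. ?N $ i $ p i) = (if p = id then 1 else 0)"
      using only_id[of p] by (simp add: diag sign_id)
  qed
  also have "\<dots> = 1"
    by (simp add: sum.delta permutes_id finite_permutations)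
  finally show ?thesis .
qed

text \<open>
  The indicator of the vertices that never reach a fixed point lies in the kernel: this set
  contains no fixed point, and a vertex belongs to it if and only if its image does.
\<close>
lemma det_successor_matrix_not_eventually_fixed:
  assumes "\<not> eventually_fixed f"
  shows "det (successor_matrix f) = 0"
proof -
  define B where "B = {v. \<forall>k. f ((f ^^ k) v) \<noteq> (f ^^ k) v}"
  have B_fixed: "u \<notin> B" if "f u = u" for u
    using that by (auto simp: B_def intro: exI[of _ 0])
  have B_step: "f u \<in> B \<longleftrightarrow> u \<in> B" if "f u \<noteq> u" for u
  proof -
    have "f ((f ^^ k) (f u)) = (f ^^ Suc (Suc k)) u" "(f ^^ k) (f u) = (f ^^ Suc k) u" for k
      by (simp_all add: funpow_swap1)
    moreover have "(\<forall>k. f ((f ^^ k) u) \<noteq> (f ^^ k) u) \<longleftrightarrow> (\<forall>k. f ((f ^^ Suc k) u) \<noteq> (f ^^ Suc k) u)"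
      using that by (metis funpow_0 not0_implies_Suc)
    ultimately show ?thesis
      by (simp add: B_def)
  qed
  define y :: "real^'a" where "y = (\<chi> v. if v \<in> B then 1 else 0)"
  have row: "(successor_matrix f *v y) $ u = (if f u = u then y $ u else y $ u - y $ (f u))" for u
    by (simp add: matrix_vector_mul_component successor_matrix_def inner_diff_left inner_axis' )
  have "successor_matrix f *v y = 0"
    using B_fixed B_step by (auto simp: vec_eq_iff row) (auto simp: y_def)
  moreover obtain v where "v \<in> B"
    using assms by (auto simp: eventually_fixed_def B_def)
  then have "y \<noteq> 0"
    by (auto simp: y_def vec_eq_iff)
  ultimately have "\<not> invertible (successor_matrix f)"
    using matrix_left_invertible_ker invertible_left_inverse by blast
  then show ?thesis
    by (simp add: invertible_det_nz)
qed

text \<open>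
  Multilinear expansion of \<open>det (X + D - A)\<close>, with \<open>X\<close> diagonal,
  over the choice of one summand in each row.
\<close>
theorem matrix_forest_theorem:
  fixes x :: "'v::finite \<Rightarrow> real" and w :: "'v \<times> 'v \<Rightarrow> real"
  assumes "\<And>u. w (u, u) = 0"
  shows "det (\<chi> u v. (if u = v then x u + (\<Sum>z\<in>UNIV. w (u, z)) else 0) - w (u, v)) =
    (\<Sum>f | eventually_fixed f. \<Prod>u\<in>UNIV. if f u = u then x u else w (u, f u))"
proof -
  define c where "c f u = (if f u = u then x u else w (u, f u))" for f u
  define a :: "'v \<Rightarrow> 'v \<Rightarrow> real^'v" where
    "a u z = (if z = u then x u *s axis u 1 else w (u, z) *s (axis u 1 - axis z 1))" for u z
  \<comment> \<open>Because of \<open>w (u, u) = 0\<close>, the summand with index \<open>u\<close> is free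
    to carry \<open>x u\<close>.\<close>
  have row: "(\<Sum>z\<in>UNIV. a u z) $ v
      = (if u = v then x u + (\<Sum>z\<in>UNIV. w (u, z)) else 0) - w (u, v)" for u v
  proof -
    have "a u z $ v = (if z = u then (if u = v then x u else 0) else 0)
        + (if u = v then w (u, z) else 0) - (if z = v then w (u, z) else 0)" for z
      using assms by (auto simp: a_def axis_def)
    then show ?thesis
      by (simp add: sum.distrib sum_subtractf)
  qed
  have det_choice: "det (\<chi> u. a u (f u)) = (if eventually_fixed f then \<Prod>u\<in>UNIV. c f u else 0)" for f
  proof -
    have "(\<chi> u. a u (f u)) = (\<chi> u. c f u *s successor_matrix f $ u)"
      by (auto simp: vec_eq_iff a_def c_def successor_matrix_def right_diff_distrib)
    then have "det (\<chi> u. a u (f u)) = (\<Prod>u\<in>UNIV. c f u) * det (\<chi> u. successor_matrix f $ u)"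
      by (simp only: det_rows_mul)
    then show ?thesis
      by (simp add: det_successor_matrix_eventually_fixed det_successor_matrix_not_eventually_fixed)
  qed
  have "(\<chi> u v. (if u = v then x u + (\<Sum>z\<in>UNIV. w (u, z)) else 0) - w (u, v))
      = (\<chi> u. \<Sum>z\<in>UNIV. a u z)"
    by (simp add: vec_eq_iff row[symmetric])
  then have "det (\<chi> u v. (if u = v then x u + (\<Sum>z\<in>UNIV. w (u, z)) else 0) - w (u, v))
      = (\<Sum>f\<in>UNIV. det (\<chi> u. a u (f u)))"
    by (simp add: det_linear_rows_sum)
  also have "\<dots> = (\<Sum>f | eventually_fixed f. \<Prod>u\<in>UNIV. c f u)"
    by (simp add: det_choice sum.If_cases)
  finally show ?thesis
    by (simp add: c_def)
qed

section \<open>Stationary vectors of an irreducible stochastic matrix\<close>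

text \<open>
  A zero at \<open>v\<close> forces, by the stationary equation at \<open>v\<close>, zeros at
  all predecessors of \<open>v\<close>, and hence everywhere.
\<close>
lemma nonneg_stationary_vanishing_somewhere:
  fixes P :: "real^'v::finite^'v"
  assumes nonneg: "\<And>u v. P $ u $ v \<ge> 0"
    and irreducible: "\<And>u v. (u, v) \<in> {(a, b). P $ a $ b > 0}\<^sup>*"
    and stat: "p v* P = p" and p: "\<And>u. p $ u \<ge> 0" and zero: "p $ v = 0"
  shows "p = 0"
proof -
  have "p $ u = 0" for u
    using irreducible[of u v]
  proof (induction rule: converse_rtrancl_induct)
    case base
    show ?case by (fact zero)
  next
    case (step a b)
    have "(\<Sum>i\<in>UNIV. P $ i $ b * p $ i) = (p v* P) $ b"
      by (simp add: vector_matrix_mult_def mult.commute)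
    also have "\<dots> = 0"
      using stat step.IH by simp
    finally have "P $ a $ b * p $ a = 0"
      by (subst (asm) sum_nonneg_eq_0_iff) (auto simp: nonneg p)
    then show ?case
      using step.hyps by auto
  qed
  then show ?thesis
    by (simp add: vec_eq_iff)
qed

text \<open>
  The triangle inequality gives \<open>\<bar>r\<bar> \<le> \<bar>r\<bar> P\<close> entrywise;
  both sides have the same total because the rows of \<open>P\<close> sum to 1, so equality
  holds in each entry.
\<close>
lemma stationary_abs:
  fixes P :: "real^'v::finite^'v"
  assumes nonneg: "\<And>u v. P $ u $ v \<ge> 0"
    and rows: "\<And>u. (\<Sum>v\<in>UNIV. P $ u $ v) = 1"
    and stat: "r v* P = r"
  shows "(\<chi> u. \<bar>r $ u\<bar>) v* P = (\<chi> u. \<bar>r $ u\<bar>)"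
proof -
  have comp: "r $ v = (\<Sum>u\<in>UNIV. P $ u $ v * r $ u)" for v
  proof -
    have "r $ v = (r v* P) $ v"
      using stat by simp
    then show ?thesis
      by (simp add: vector_matrix_mult_def mult.commute)
  qed
  have le: "\<bar>r $ v\<bar> \<le> (\<Sum>u\<in>UNIV. P $ u $ v * \<bar>r $ u\<bar>)" for v
    unfolding comp[of v]
    by (rule order_trans[OF sum_abs]) (simp add: abs_mult nonneg)
  have "(\<Sum>v\<in>UNIV. \<Sum>u\<in>UNIV. P $ u $ v * \<bar>r $ u\<bar>) = (\<Sum>u\<in>UNIV. (\<Sum>v\<in>UNIV. P $ u $ v) * \<bar>r $ u\<bar>)"
    by (subst sum.swap) (simp add: sum_distrib_right)
  then have "(\<Sum>v\<in>UNIV. \<bar>r $ v\<bar>) = (\<Sum>v\<in>UNIV. \<Sum>u\<in>UNIV. P $ u $ v * \<bar>r $ u\<bar>)"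
    by (simp add: rows)
  then have "\<bar>r $ v\<bar> = (\<Sum>u\<in>UNIV. P $ u $ v * \<bar>r $ u\<bar>)" for v
    by (rule sum_mono_inv) (use le in auto)
  from this[symmetric] show ?thesis
    by (simp add: vector_matrix_mult_def vec_eq_iff mult.commute)
qed

text \<open>
  This one-dimensionality statement yields the uniqueness of the stationary distribution and
  the invertibility of the corrected Laplacian. The vector \<open>\<bar>r\<bar> + r\<close> is
  stationary and nonnegative, and it vanishes wherever \<open>r \<le> 0\<close>; as
  \<open>r\<close> has total 0 there is such a vertex.
\<close>
lemma stationary_sum_zero:
  fixes P :: "real^'v::finite^'v"
  assumes nonneg: "\<And>u v. P $ u $ v \<ge> 0"
    and rows: "\<And>u. (\<Sum>v\<in>UNIV. P $ u $ v) = 1"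
    and irreducible: "\<And>u v. (u, v) \<in> {(a, b). P $ a $ b > 0}\<^sup>*"
    and stat: "r v* P = r" and sum: "(\<Sum>u\<in>UNIV. r $ u) = 0"
  shows "r = 0"
proof -
  define s where "s = (\<chi> u. \<bar>r $ u\<bar>) + r"
  obtain v where v: "r $ v \<le> 0"
    using sum sum_pos[of UNIV "\<lambda>u. r $ u"] by (metis UNIV_not_empty finite less_irrefl not_le)
  have "s v* P = s"
    by (simp add: s_def vector_matrix_left_distrib stat stationary_abs[OF nonneg rows stat])
  then have "s = 0"
    by (rule nonneg_stationary_vanishing_somewhere[OF nonneg irreducible, where v = v])
      (use v in \<open>auto simp: s_def\<close>)
  then have le: "r $ u \<le> 0" for u
  proof -
    have "s $ u = 0"
      using \<open>s = 0\<close> by simp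
    then show ?thesis
      by (simp add: s_def)
  qed
  have "(\<Sum>u\<in>UNIV. - r $ u) = 0"
    using sum by (simp add: sum_negf)
  then have "\<forall>u. - r $ u = 0"
    using le by (subst (asm) sum_nonneg_eq_0_iff) auto
  then show ?thesis
    by (simp add: vec_eq_iff)
qed

text \<open>
  The constant vector lies in the right kernel of \<open>1 - P\<close>, so there is a nonzero
  left kernel vector; its absolute value, normalized, is the distribution.
\<close>
lemma stationary_distribution_exists:
  fixes P :: "real^'v::finite^'v"
  assumes nonneg: "\<And>u v. P $ u $ v \<ge> 0"
    and rows: "\<And>u. (\<Sum>v\<in>UNIV. P $ u $ v) = 1"
    and irreducible: "\<And>u v. (u, v) \<in> {(a, b). P $ a $ b > 0}\<^sup>*"
  shows "\<exists>p. is_stationary_distribution P p"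
proof -
  have "(mat 1 - P) *v 1 = 0"
    using rows by (simp add: vec_eq_iff matrix_vector_mult_def mat_def sum_subtractf)
  moreover have "(1 :: real^'v) \<noteq> 0"
    by simp
  ultimately have "\<not> invertible (mat 1 - P)"
    using matrix_left_invertible_ker invertible_left_inverse by blast
  then have "\<not> invertible (transpose (mat 1 - P))"
    using transpose_invertible by fastforce
  then obtain r where r: "transpose (mat 1 - P) *v r = 0" "r \<noteq> 0"
    using matrix_left_invertible_ker invertible_left_inverse by blast
  have stat: "r v* P = r"
    using r(1) by (simp add: transpose_matrix_vector vector_matrix_mult_diff_rdistrib)
  define q where "q = (\<chi> u. \<bar>r $ u\<bar>)"
  have q: "q v* P = q"
    unfolding q_def by (rule stationary_abs[OF nonneg rows stat])
  have "q \<noteq> 0"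
    using r(2) by (auto simp: q_def vec_eq_iff)
  have pos: "q $ u > 0" for u
  proof (rule ccontr)
    assume "\<not> q $ u > 0"
    then have "q $ u = 0"
      by (simp add: q_def)
    then have "q = 0"
      using nonneg_stationary_vanishing_somewhere[OF nonneg irreducible q] by (simp add: q_def)
    then show False
      using \<open>q \<noteq> 0\<close> by simp
  qed
  define t where "t = (\<Sum>u\<in>UNIV. q $ u)"
  have t: "t > 0"
    unfolding t_def by (intro sum_pos pos) auto
  have "is_stationary_distribution P ((1 / t) *\<^sub>R q)"
    unfolding is_stationary_distribution_def
  proof (intro conjI allI)
    show "((1 / t) *\<^sub>R q) $ u > 0" for u
      using pos t by simp
    show "(\<Sum>u\<in>UNIV. ((1 / t) *\<^sub>R q) $ u) = 1"
      using t by (simp add: sum_divide_distrib[symmetric]) (simp add: t_def)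
    show "((1 / t) *\<^sub>R q) v* P = (1 / t) *\<^sub>R q"
      by (metis q scaleR_vector_matrix_assoc)
  qed
  then show ?thesis ..
qed

lemma stationary_distribution_unique:
  fixes P :: "real^'v::finite^'v"
  assumes nonneg: "\<And>u v. P $ u $ v \<ge> 0"
    and rows: "\<And>u. (\<Sum>v\<in>UNIV. P $ u $ v) = 1"
    and irreducible: "\<And>u v. (u, v) \<in> {(a, b). P $ a $ b > 0}\<^sup>*"
    and "is_stationary_distribution P p" "is_stationary_distribution P q"
  shows "p = q"
proof -
  have "(p - q) v* P = p - q"
    using assms(4,5) by (simp add: is_stationary_distribution_def vector_matrix_mult_diff_distrib)
  moreover have "(\<Sum>u\<in>UNIV. (p - q) $ u) = 0"
    using assms(4,5) by (simp add: is_stationary_distribution_def sum_subtractf)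
  ultimately have "p - q = 0"
    by (rule stationary_sum_zero[OF nonneg rows irreducible])
  then show ?thesis
    by simp
qed

section \<open>The Moore-Penrose inverse\<close>

lemma moore_penrose_inverse_unique:
  assumes X: "is_moore_penrose_inverse A X" and Y: "is_moore_penrose_inverse A Y"
  shows "X = Y"
proof -
  note X' = X[unfolded is_moore_penrose_inverse_def] and Y' = Y[unfolded is_moore_penrose_inverse_def]
  have "A ** X = (A ** Y) ** (A ** X)"
    using Y' by (simp add: matrix_mul_assoc)
  also have "\<dots> = transpose (A ** Y) ** transpose (A ** X)"
    using X' Y' by simp
  also have "\<dots> = transpose (A ** X ** A ** Y)"
    by (simp add: matrix_transpose_mul[symmetric] matrix_mul_assoc)
  also have "\<dots> = A ** Y"
    using X' Y' by simp
  finally have AX: "A ** X = A ** Y" .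
  have "X ** A = (X ** A) ** (Y ** A)"
    using Y' by (simp add: matrix_mul_assoc[symmetric])
  also have "\<dots> = transpose (X ** A) ** transpose (Y ** A)"
    using X' Y' by simp
  also have "\<dots> = transpose (Y ** (A ** X ** A))"
    by (simp add: matrix_transpose_mul[symmetric] matrix_mul_assoc)
  also have "\<dots> = Y ** A"
    using X' Y' by simp
  finally have XA: "X ** A = Y ** A" .
  have "X = X ** A ** X"
    using X' by simp
  also have "\<dots> = Y ** A ** Y"
    using AX XA by (simp add: matrix_mul_assoc[symmetric])
  also have "\<dots> = Y"
    using Y' by simp
  finally show ?thesis .
qed

lemma moore_penrose_inverse_eqI:
  "is_moore_penrose_inverse A X \<Longrightarrow> moore_penrose_inverse A = X"
  unfolding moore_penrose_inverse_def
  using moore_penrose_inverse_unique by blast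

lemma matrix_add_rdistrib: "(A + B) ** C = A ** C + B ** (C :: real^'n^'m)"
  by (simp add: vec_eq_iff matrix_matrix_mult_def distrib_right sum.distrib)

lemma matrix_diff_ldistrib: "A ** (B - C) = A ** B - A ** (C :: real^'n^'m)"
  by (simp add: vec_eq_iff matrix_matrix_mult_def right_diff_distrib sum_subtractf)

lemma matrix_diff_rdistrib: "(A - B) ** C = A ** C - B ** (C :: real^'n^'m)"
  by (simp add: vec_eq_iff matrix_matrix_mult_def left_diff_distrib sum_subtractf)

text \<open>
  If \<open>J\<close> is an orthogonal projection with \<open>N ** J = 0 = J ** N\<close> and
  \<open>N + J\<close> is invertible, then its image is the kernel of \<open>N\<close> as well
  as that of the transpose of \<open>N\<close>. On the orthogonal complement \<open>N +
  J\<close> agrees with \<open>N\<close>, and on the image of \<open>J\<close> it is the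
  identity, which subtracting \<open>J\<close> removes from the inverse.
\<close>
lemma moore_penrose_inverse_common_kernel:
  fixes N J :: "real^'n^'n"
  assumes NJ: "N ** J = 0" and JN: "J ** N = 0" and JJ: "J ** J = J" and tJ: "transpose J = J"
    and inv: "invertible (N + J)"
  shows "moore_penrose_inverse N = matrix_inv (N + J) - J"
proof (rule moore_penrose_inverse_eqI)
  define M where "M = N + J"
  define K where "K = matrix_inv M"
  note MK = matrix_inv_mult[OF inv, folded M_def, folded K_def]
  have "M ** J = J" "J ** M = J"
    by (simp_all add: M_def matrix_add_ldistrib matrix_add_rdistrib NJ JN JJ)
  then have KJ: "K ** J = J" and JK: "J ** K = J"
    using MK by (metis matrix_mul_assoc matrix_mul_lid, metis matrix_mul_assoc matrix_mul_rid)
  have N: "N = M - J"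
    by (simp add: M_def)
  have NG: "N ** (K - J) = mat 1 - J" and GN: "(K - J) ** N = mat 1 - J"
    by (simp_all add: N matrix_diff_ldistrib matrix_diff_rdistrib MK KJ JK JJ
        \<open>M ** J = J\<close> \<open>J ** M = J\<close>)
  have "transpose (mat 1 - J) = mat 1 - J"
    using tJ by (simp add: transpose_def mat_def vec_eq_iff)
  then show "is_moore_penrose_inverse N (matrix_inv (N + J) - J)"
    unfolding M_def[symmetric] K_def[symmetric] is_moore_penrose_inverse_def NG GN
    by (simp add: matrix_diff_ldistrib matrix_diff_rdistrib JN JK JJ)
qed

section \<open>The trace of the pseudoinverse from the characteristic polynomial\<close>

text \<open>
  A permutation other than the identity moves at least two points, so its term in the Leibniz
  expansion vanishes to second order at 0.
\<close>
lemma det_one_plus_has_derivative: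
  fixes B :: "real^'n^'n"
  shows "((\<lambda>x. det (mat 1 + x *\<^sub>R B)) has_real_derivative trace B) (at 0)"
proof -
  let ?e = "\<lambda>i j. if i = j then 1 else (0::real)"
  have prod: "((\<lambda>x. \<Prod>i\<in>UNIV. ?e i (p i) + x * B $ i $ p i) has_real_derivative
      (if p = id then trace B else 0)) (at 0)" if p: "p permutes UNIV" for p
  proof -
    have "((\<lambda>x. \<Prod>i\<in>UNIV. ?e i (p i) + x * B $ i $ p i) has_real_derivative
        (\<Sum>i\<in>UNIV. B $ i $ p i * (\<Prod>j\<in>UNIV - {i}. ?e j (p j) + 0 * B $ j $ p j))) (at 0)"
      by (rule has_field_derivative_prod) (auto intro!: derivative_eq_intros)
    moreover have "(\<Sum>i\<in>UNIV. B $ i $ p i * (\<Prod>j\<in>UNIV - {i}. ?e j (p j) + 0 * B $ j $ p j))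
        = (if p = id then trace B else 0)"
    proof (cases "p = id")
      case True
      then show ?thesis by (simp add: trace_def)
    next
      case False
      then obtain k where k: "p k \<noteq> k"
        by (metis eq_id_iff)
      have "p (p k) \<noteq> p k"
        using k permutes_inj[OF p] by (auto dest: injD)
      have "(\<Prod>j\<in>UNIV - {i}. ?e j (p j) + 0 * B $ j $ p j) = 0" for i
      proof -
        \<comment> \<open>Both \<open>k\<close> and \<open>p k\<close> are moved by \<open>p\<close>, and at
          least one of them differs from \<open>i\<close>.\<close>
        have "(if i = k then p k else k) \<in> UNIV - {i}"
          and "p (if i = k then p k else k) \<noteq> (if i = k then p k else k)"
          using k \<open>p (p k) \<noteq> p k\<close> by auto
        then show ?thesis
          by (intro prod_zero bexI[of _ "if i = k then p k else k"]) auto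
      qed
      then show ?thesis
        using False by (simp only: mult_zero_right sum.neutral_const if_False)
    qed
    ultimately show ?thesis by simp
  qed
  have "((\<lambda>x. \<Sum>p\<in>{p. p permutes UNIV}. of_int (sign p) * (\<Prod>i\<in>UNIV. ?e i (p i) + x * B $ i $ p i))
      has_real_derivative
      (\<Sum>p\<in>{p. p permutes (UNIV::'n set)}. of_int (sign p) * (if p = id then trace B else 0))) (at 0)"
    by (intro DERIV_sum DERIV_cmult prod) auto
  moreover have "(\<Sum>p\<in>{p. p permutes (UNIV::'n set)}. of_int (sign p) * (if p = id then trace B else 0))
      = trace B"
    by (simp add: if_distrib[of "\<lambda>x. _ * x"] sum.delta finite_permutations permutes_id sign_id cong: if_cong)
  ultimately show ?thesis
    by (simp add: det_def mat_def)
qed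

lemma mat_mult_left: "mat x ** A = x *\<^sub>R (A :: real^'n^'m)"
  by (simp add: vec_eq_iff matrix_matrix_mult_def mat_def if_distrib[of "\<lambda>x. x * _"] sum.delta cong: if_cong)

lemma mat_mult_right: "A ** mat x = x *\<^sub>R (A :: real^'n^'m)"
  by (simp add: vec_eq_iff matrix_matrix_mult_def mat_def if_distrib[of "\<lambda>x. _ * x"] sum.delta' mult.commute cong: if_cong)

lemma det_mat_plus_has_derivative:
  fixes M :: "real^'n^'n"
  assumes "invertible M"
  shows "((\<lambda>x. det (mat x + M)) has_real_derivative det M * trace (matrix_inv M)) (at 0)"
proof -
  have "mat x + M = M ** (mat 1 + x *\<^sub>R matrix_inv M)" for x
    by (simp add: matrix_add_ldistrib mat_mult_right[symmetric] matrix_mul_assoc matrix_inv_mult[OF assms])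
  then have "det (mat x + M) = det M * det (mat 1 + x *\<^sub>R matrix_inv M)" for x
    by (simp add: det_mul)
  then show ?thesis
    by (simp add: DERIV_cmult det_one_plus_has_derivative)
qed

text \<open>
  For \<open>h t = det (1 + t J)\<close>, idempotency of \<open>J\<close> gives \<open>h a * h
  b = h (a + b + a b)\<close>. Together with \<open>h' 0 = 1\<close>, the value of the trace,
  this is the differential equation \<open>h' = h / (1 + t)\<close>, whose solution with
  \<open>h 0 = 1\<close> is \<open>1 + t\<close>.
\<close>
lemma det_one_plus_projection:
  fixes J :: "real^'n^'n"
  assumes JJ: "J ** J = J" and tr: "trace J = 1" and "t \<ge> 0"
  shows "det (mat 1 + t *\<^sub>R J) = 1 + t"
proof -
  define h where "h t = det (mat 1 + t *\<^sub>R J)" for t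
  have mult: "h a * h b = h (a + b + a * b)" for a b
  proof -
    have "(mat 1 + a *\<^sub>R J) ** (mat 1 + b *\<^sub>R J) = mat 1 + (a + b + a * b) *\<^sub>R J"
      by (simp add: matrix_add_ldistrib matrix_add_rdistrib matrix_scalar_ac
          scalar_matrix_assoc[symmetric] JJ scaleR_add_left scaleR_add_right add_ac mult.commute)
    then show ?thesis
      by (simp add: h_def det_mul[symmetric])
  qed
  have h0: "(h has_real_derivative 1) (at 0)"
    using det_one_plus_has_derivative[of J] tr by (simp add: h_def[abs_def])
  have h_deriv: "(h has_real_derivative h s / (1 + s)) (at s)" if "s \<ge> 0" for s
  proof -
    \<comment> \<open>Multiplicativity with \<open>b = (y - s) / (1 + s)\<close>, chosen so that \<open>s +
      b + s b = y\<close>.\<close>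
    have shift: "h s * h ((y - s) / (1 + s)) = h y" for y
    proof -
      have "s + (y - s) / (1 + s) + s * ((y - s) / (1 + s)) = y"
      proof -
        have "s + (y - s) / (1 + s) + s * ((y - s) / (1 + s)) = s + (1 + s) * ((y - s) / (1 + s))"
          by (simp only: distrib_right mult_1_left add.assoc)
        also have "(1 + s) * ((y - s) / (1 + s)) = y - s"
          using that by simp
        finally show ?thesis
          by simp
      qed
      then show ?thesis
        by (simp add: mult)
    qed
    have "((\<lambda>y. h s * h ((y - s) / (1 + s))) has_real_derivative h s * (1 * (1 / (1 + s)))) (at s)"
    proof (intro DERIV_cmult DERIV_chain2[of h])
      show "(h has_real_derivative 1) (at ((s - s) / (1 + s)))"
        using h0 by simp
      show "((\<lambda>y. (y - s) / (1 + s)) has_real_derivative 1 / (1 + s)) (at s)"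
        using that by (auto intro!: derivative_eq_intros)
    qed
    then show ?thesis
      by (simp only: shift mult_1_left) simp
  qed
  have "((\<lambda>s. h s / (1 + s)) has_real_derivative 0) (at s within {0..})" if "s \<in> {0..}" for s
  proof -
    have "((\<lambda>s. h s / (1 + s)) has_real_derivative
        (h s / (1 + s) * (1 + s) - h s * 1) / ((1 + s) * (1 + s))) (at s)"
      using that by (intro DERIV_divide h_deriv) (auto intro!: derivative_eq_intros)
    moreover have "h s / (1 + s) * (1 + s) - h s * 1 = 0"
      using that by simp
    ultimately show ?thesis
      by (simp only: div_0) (rule has_field_derivative_at_within)
  qed
  then obtain c where c: "\<And>s. s \<in> {0..} \<Longrightarrow> h s / (1 + s) = c"
    using has_field_derivative_zero_constant[of "{0..}" "\<lambda>s. h s / (1 + s)"] by auto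
  have "c = 1"
    using c[of 0] by (simp add: h_def)
  then show ?thesis
    using c[of t] \<open>t \<ge> 0\<close> by (simp add: h_def)
qed

text \<open>
  The logarithmic derivative of \<open>det (x + M)\<close> at 0, where \<open>M = N +
  J\<close>, is the trace of the inverse of \<open>M\<close>, which exceeds the wanted trace
  by \<open>trace J = 1\<close>. On the other hand, \<open>det (x + M) = (1 + x) * (c\<^sub>0
  + c\<^sub>1 x + ...)\<close> if \<open>det (x + N) = c\<^sub>0 x + c\<^sub>1 x\<^sup>2 +
  ...\<close>, so this logarithmic derivative is \<open>(c\<^sub>0 + c\<^sub>1) /
  c\<^sub>0\<close>.
\<close>
lemma trace_moore_penrose_inverse_common_kernel:
  fixes N J :: "real^'n^'n" and a :: "'i \<Rightarrow> real"
  assumes NJ: "N ** J = 0" and JN: "J ** N = 0" and JJ: "J ** J = J" and tJ: "transpose J = J"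
    and inv: "invertible (N + J)" and tr: "trace J = 1"
    and det: "\<And>x. x > 0 \<Longrightarrow> det (mat x + N) = (\<Sum>i\<in>I. a i * x ^ Suc (k i))"
    and "finite I"
  shows "trace (moore_penrose_inverse N) =
    (\<Sum>i | i \<in> I \<and> k i = 1. a i) / (\<Sum>i | i \<in> I \<and> k i = 0. a i)"
proof -
  define M where "M = N + J"
  define c0 where "c0 = (\<Sum>i | i \<in> I \<and> k i = 0. a i)"
  define c1 where "c1 = (\<Sum>i | i \<in> I \<and> k i = 1. a i)"
  define H where "H x = det (mat x + M)" for x
  define p where "p x = (1 + x) * (\<Sum>i\<in>I. a i * x ^ k i)" for x
  have Hp: "H x = p x" if "x > 0" for x
  proof -
    have "mat x + M = (mat x + N) ** (mat 1 + (1 / x) *\<^sub>R J)"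
      using that by (simp add: M_def matrix_add_ldistrib matrix_add_rdistrib matrix_scalar_ac
          scalar_matrix_assoc[symmetric] mat_mult_left NJ)
    then have "H x = det (mat x + N) * (1 + 1 / x)"
      using that by (simp add: H_def det_mul det_one_plus_projection[OF JJ tr])
    also have "det (mat x + N) = x * (\<Sum>i\<in>I. a i * x ^ k i)"
      using that by (simp add: det sum_distrib_left mult_ac)
    also have "x * (\<Sum>i\<in>I. a i * x ^ k i) * (1 + 1 / x) = (x * (1 + 1 / x)) * (\<Sum>i\<in>I. a i * x ^ k i)"
      by (simp only: mult_ac)
    also have "x * (1 + 1 / x) = 1 + x"
      using that by (simp add: distrib_left)
    finally show ?thesis
      by (simp add: p_def)
  qed
  have H': "(H has_real_derivative det M * trace (matrix_inv M)) (at 0)"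
    unfolding H_def[abs_def] using inv by (intro det_mat_plus_has_derivative) (simp add: M_def)
  have sum0: "(\<Sum>i\<in>I. a i * 0 ^ k i) = c0"
    unfolding c0_def using \<open>finite I\<close>
    by (intro sum.mono_neutral_cong_right) auto
  have term': "((\<lambda>x. a i * x ^ k i) has_real_derivative (if k i = 1 then a i else 0)) (at 0)" for i
    by (auto intro!: derivative_eq_intros simp: power_0_left)
  have sum': "((\<lambda>x. \<Sum>i\<in>I. a i * x ^ k i) has_real_derivative c1) (at 0)"
  proof -
    have "((\<lambda>x. \<Sum>i\<in>I. a i * x ^ k i) has_real_derivative (\<Sum>i\<in>I. if k i = 1 then a i else 0)) (at 0)"
      by (intro DERIV_sum term')
    moreover have "(\<Sum>i\<in>I. if k i = 1 then a i else 0) = c1"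
      unfolding c1_def using \<open>finite I\<close> by (intro sum.mono_neutral_cong_right) auto
    ultimately show ?thesis by simp
  qed
  have p': "(p has_real_derivative c0 + c1) (at 0)"
  proof -
    have "(p has_real_derivative 1 * (\<Sum>i\<in>I. a i * 0 ^ k i) + c1 * (1 + 0)) (at 0)"
      unfolding p_def[abs_def] by (intro DERIV_mult sum') (auto intro!: derivative_eq_intros)
    then show ?thesis
      by (simp add: sum0)
  qed
  \<comment> \<open>The factorization divides by \<open>x\<close>, so the values and the derivatives at 0
    are compared through one-sided limits.\<close>
  have ev: "\<forall>\<^sub>F x in at_right 0. H x = p x"
    by (simp add: eventually_at_right_less Hp eventually_mono[OF eventually_at_right_less])
  have "(H \<longlongrightarrow> H 0) (at_right 0)" "(p \<longlongrightarrow> p 0) (at_right 0)"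
    using DERIV_isCont[OF H'] DERIV_isCont[OF p']
    by (auto simp: isCont_def intro: tendsto_within_subset[of _ _ _ UNIV])
  then have H0: "H 0 = p 0"
    using tendsto_unique[of "at_right (0::real)" H "H 0" "p 0"] tendsto_cong[OF ev] by auto
  have "((\<lambda>y. (H y - H 0) / (y - 0)) \<longlongrightarrow> det M * trace (matrix_inv M)) (at_right 0)"
    "((\<lambda>y. (p y - p 0) / (y - 0)) \<longlongrightarrow> c0 + c1) (at_right 0)"
    using has_field_derivative_at_within[OF H', of "{0<..}"]
      has_field_derivative_at_within[OF p', of "{0<..}"]
    by (simp_all add: has_field_derivative_iff)
  moreover have "\<forall>\<^sub>F y in at_right 0. (H y - H 0) / (y - 0) = (p y - p 0) / (y - 0)"
    using ev by eventually_elim (simp add: H0)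
  ultimately have "((\<lambda>y. (p y - p 0) / (y - 0)) \<longlongrightarrow> det M * trace (matrix_inv M)) (at_right 0)"
    and p_lim: "((\<lambda>y. (p y - p 0) / (y - 0)) \<longlongrightarrow> c0 + c1) (at_right 0)"
    by (auto elim: Lim_transform_eventually)
  then have tr_eq: "det M * trace (matrix_inv M) = c0 + c1"
    by (intro tendsto_unique[OF trivial_limit_at_right_real])
  have "det M = c0"
    using H0 by (simp add: H_def p_def sum0)
  moreover have "det M \<noteq> 0"
    using inv by (simp add: M_def invertible_det_nz)
  ultimately have "trace (matrix_inv M) - 1 = c1 / c0"
    using tr_eq by (simp add: field_simps)
  then show ?thesis
    by (simp add: moore_penrose_inverse_common_kernel[OF NJ JN JJ tJ inv] trace_sub tr M_def c0_def c1_def)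
qed

section \<open>Weak components\<close>

definition component_of :: "'a pair_pre_digraph \<Rightarrow> 'a \<Rightarrow> 'a pair_pre_digraph" where
  "component_of F u =
     \<lparr>pverts = {v. (u, v) \<in> (parcs F \<union> (parcs F)\<inverse>)\<^sup>*},
      parcs = {e \<in> parcs F. (u, fst e) \<in> (parcs F \<union> (parcs F)\<inverse>)\<^sup>*}\<rparr>"

lemma component_of_simps:
  "pverts (component_of F u) = {v. (u, v) \<in> (parcs F \<union> (parcs F)\<inverse>)\<^sup>*}"
  "parcs (component_of F u) = {e \<in> parcs F. (u, fst e) \<in> (parcs F \<union> (parcs F)\<inverse>)\<^sup>*}"
  by (simp_all add: component_of_def)

lemma self_in_component_of: "u \<in> pverts (component_of F u)"
  by (simp add: component_of_simps)

lemma component_of_arc: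
  assumes "u \<in> pverts (component_of F x)" "(u, v) \<in> parcs F"
  shows "(u, v) \<in> parcs (component_of F x)" "v \<in> pverts (component_of F x)"
  using assms by (auto simp: component_of_simps intro: rtrancl_into_rtrancl)

lemma subgraph_component_of:
  assumes "pair_wf_digraph F" "u \<in> pverts F"
  shows "subgraph (with_proj (component_of F u)) (with_proj F)"
proof (rule subgraphI)
  interpret F: pair_wf_digraph F by fact
  have in_F: "v \<in> pverts F" if "(u, v) \<in> (parcs F \<union> (parcs F)\<inverse>)\<^sup>*" for v
    using that \<open>u \<in> pverts F\<close>
    by (induction rule: rtrancl_induct) (auto dest: F.in_arcsD1 F.in_arcsD2)
  then show "verts (with_proj (component_of F u)) \<subseteq> verts (with_proj F)"
    by (auto simp: component_of_simps)
  show "arcs (with_proj (component_of F u)) \<subseteq> arcs (with_proj F)"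
    by (auto simp: component_of_simps)
  show "wf_digraph (with_proj F)"
    by unfold_locales
  show "wf_digraph (with_proj (component_of F u))"
    by unfold_locales (auto simp: component_of_simps intro: rtrancl_into_rtrancl)
qed (rule compatibleI_with_proj)

lemma mk_symmetric_arcs:
  assumes "tail H = fst" "head H = snd"
  shows "parcs (mk_symmetric H) = arcs H \<union> (arcs H)\<inverse>"
  using assms by (auto simp: parcs_mk_symmetric)

lemma connected_component_of:
  assumes "pair_wf_digraph F" "u \<in> pverts F"
  shows "Digraph_Component.connected (with_proj (component_of F u))"
proof -
  let ?C = "component_of F u"
  have "wf_digraph (with_proj ?C)"
    using subgraph_component_of[OF assms] by (auto simp: subgraph_def)
  then interpret S: pair_wf_digraph "mk_symmetric (with_proj ?C)"
    by (rule wf_digraph.wellformed_mk_symmetric)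
  have arcs: "parcs (mk_symmetric (with_proj ?C)) = parcs ?C \<union> (parcs ?C)\<inverse>"
    by (simp add: mk_symmetric_arcs)
  have from_u: "u \<rightarrow>\<^sup>*\<^bsub>with_proj (mk_symmetric (with_proj ?C))\<^esub> v"
    if "(u, v) \<in> (parcs F \<union> (parcs F)\<inverse>)\<^sup>*" for v
    using that
  proof (induction rule: rtrancl_induct)
    case base
    show ?case
      by (rule S.reachable_refl) (simp add: component_of_simps)
  next
    case (step y z)
    have "(u, z) \<in> (parcs F \<union> (parcs F)\<inverse>)\<^sup>*"
      using step.hyps by (rule rtrancl_into_rtrancl)
    then have "(y, z) \<in> parcs (mk_symmetric (with_proj ?C))"
      using step.hyps unfolding arcs by (auto simp: component_of_simps)
    then show ?case
      using step.IH S.reachable_adj_trans by simp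
  qed
  have to_u: "v \<rightarrow>\<^sup>*\<^bsub>with_proj (mk_symmetric (with_proj ?C))\<^esub> u"
    if "(u, v) \<in> (parcs F \<union> (parcs F)\<inverse>)\<^sup>*" for v
    using from_u[OF that] by (rule symmetric_reachable[OF symmetric_mk_symmetric])
  show ?thesis
    unfolding Digraph_Component.connected_def
  proof
    show "verts (with_proj (mk_symmetric (with_proj ?C))) \<noteq> {}"
      using self_in_component_of[of u F] by auto
  next
    fix v w
    assume "v \<in> verts (with_proj (mk_symmetric (with_proj ?C)))"
      and "w \<in> verts (with_proj (mk_symmetric (with_proj ?C)))"
    then show "v \<rightarrow>\<^sup>*\<^bsub>with_proj (mk_symmetric (with_proj ?C))\<^esub> w"
      using S.reachable_trans[OF to_u[of v] from_u[of w]] by (simp add: component_of_simps)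
  qed
qed

text \<open>
  This is the maximality of \<open>component_of F u\<close> among the connected subgraphs that
  contain \<open>u\<close>.
\<close>
lemma connected_subgraph_of_component_of:
  assumes sub: "subgraph H (with_proj F)" and con: "Digraph_Component.connected H"
    and u: "u \<in> verts H"
  shows "subgraph H (with_proj (component_of F u))"
proof -
  have H: "arcs H \<subseteq> parcs F" "tail H = fst" "head H = snd" "wf_digraph H" "wf_digraph (with_proj F)"
    using sub by (auto simp: subgraph_def compatible_def)
  have "u \<in> pverts F"
    using sub u by (auto simp: subgraph_def)
  have verts: "(u, v) \<in> (parcs F \<union> (parcs F)\<inverse>)\<^sup>*" if "v \<in> verts H" for v
  proof -
    have "u \<rightarrow>\<^sup>*\<^bsub>with_proj (mk_symmetric H)\<^esub> v"
      using con u that by (auto simp: Digraph_Component.connected_def)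
    then have "(u, v) \<in> (parcs (mk_symmetric H))\<^sup>*"
      by (auto simp: reachable_def dest: rtrancl_on_rtranclI)
    then show ?thesis
      using rtrancl_mono[of "parcs (mk_symmetric H)" "parcs F \<union> (parcs F)\<inverse>"] H
      by (auto simp: mk_symmetric_arcs)
  qed
  have "wf_digraph (with_proj (component_of F u))"
    by unfold_locales (auto simp: component_of_simps intro: rtrancl_into_rtrancl)
  moreover have "arcs H \<subseteq> parcs (component_of F u)"
  proof
    fix e assume e: "e \<in> arcs H"
    then have "fst e \<in> verts H"
      using wf_digraph.tail_in_verts[OF H(4)] H(2) by metis
    then show "e \<in> parcs (component_of F u)"
      using e H(1) verts by (auto simp: component_of_simps)
  qed
  ultimately show ?thesis
    using H verts by (auto simp: subgraph_def compatible_def component_of_simps)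
qed

lemma subgraph_antisym:
  assumes "subgraph G H" "subgraph H G"
  shows "G = H"
  using assms by (auto simp: subgraph_def compatible_def intro!: pre_digraph.equality)

lemma with_proj_inject: "with_proj F = with_proj G \<longleftrightarrow> F = G"
  by (metis pair_pre_digraph.equality old.unit.exhaust with_proj_simps(1,2))

lemma weak_components_eq:
  assumes "pair_wf_digraph F"
  shows "weak_components F = component_of F ` pverts F"
proof (intro equalityI subsetI)
  fix T assume "T \<in> component_of F ` pverts F"
  then obtain u where u: "u \<in> pverts F" and T: "T = component_of F u"
    by blast
  have "H = with_proj T"
    if "subgraph (with_proj T) H" "subgraph H (with_proj F)" "Digraph_Component.connected H" for H
  proof -
    have "u \<in> verts H"
      using that(1) self_in_component_of[of u F] by (auto simp: subgraph_def T)
    then have "subgraph H (with_proj T)"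
      unfolding T by (intro connected_subgraph_of_component_of that(2,3))
    then show ?thesis
      using that(1) by (rule subgraph_antisym)
  qed
  then show "T \<in> weak_components F"
    using subgraph_component_of[OF assms u] connected_component_of[OF assms u]
    unfolding weak_components_def by (auto simp: T pre_digraph.max_subgraph_def)
next
  fix T assume "T \<in> weak_components F"
  then have max: "pre_digraph.max_subgraph (with_proj F) Digraph_Component.connected (with_proj T)"
    by (simp add: weak_components_def)
  then have sub: "subgraph (with_proj T) (with_proj F)" and con: "Digraph_Component.connected (with_proj T)"
    by (auto simp: pre_digraph.max_subgraph_def)
  obtain u where u: "u \<in> pverts T"
    using con by (auto simp: Digraph_Component.connected_def strongly_connected_def)
  then have uF: "u \<in> pverts F"
    using sub by (auto simp: subgraph_def)
  have "subgraph (with_proj T) (with_proj (component_of F u))"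
    using connected_subgraph_of_component_of[OF sub con] u by simp
  then have "with_proj (component_of F u) = with_proj T"
    using max subgraph_component_of[OF assms uF] connected_component_of[OF assms uF]
    unfolding pre_digraph.max_subgraph_def by blast
  then show "T \<in> component_of F ` pverts F"
    using uF by (auto simp: with_proj_inject)
qed

section \<open>The functional digraph of an eventually fixed function\<close>

text \<open>
  The number of steps to the fixed point. On an arc of the functional digraph it drops by one,
  which is what excludes cycles of the underlying undirected graph.
\<close>
definition depth :: "('v \<Rightarrow> 'v) \<Rightarrow> 'v \<Rightarrow> nat" where
  "depth f v = (LEAST k. f ((f ^^ k) v) = (f ^^ k) v)"

definition sink :: "('v \<Rightarrow> 'v) \<Rightarrow> 'v \<Rightarrow> 'v" where
  "sink f v = (f ^^ depth f v) v"

lemma sink_fixed: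
  assumes "eventually_fixed f"
  shows "f (sink f v) = sink f v"
  unfolding sink_def depth_def
  by (rule LeastI_ex) (use assms in \<open>auto simp: eventually_fixed_def\<close>)

lemma sink_of_fixed: "f r = r \<Longrightarrow> sink f r = r"
  by (simp add: sink_def depth_def Least_eq_0)

lemma depth_step:
  assumes "eventually_fixed f" "f v \<noteq> v"
  shows "depth f v = Suc (depth f (f v))"
proof -
  obtain k where "f ((f ^^ k) v) = (f ^^ k) v"
    using assms(1) by (auto simp: eventually_fixed_def)
  then have "depth f v = Suc (LEAST m. f ((f ^^ Suc m) v) = (f ^^ Suc m) v)"
    unfolding depth_def by (rule Least_Suc) (use assms(2) in simp)
  then show ?thesis
    by (simp add: depth_def funpow_swap1)
qed

lemma sink_step:
  assumes "eventually_fixed f"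
  shows "sink f (f v) = sink f v"
proof (cases "f v = v")
  case False
  then show ?thesis
    using depth_step[OF assms False] by (simp add: sink_def funpow_swap1)
qed simp

definition successor_graph :: "('v \<Rightarrow> 'v) \<Rightarrow> 'v pair_pre_digraph" where
  "successor_graph f = \<lparr>pverts = UNIV, parcs = {(u, f u) | u. f u \<noteq> u}\<rparr>"

lemma successor_graph_simps:
  "pverts (successor_graph f) = UNIV"
  "(u, v) \<in> parcs (successor_graph f) \<longleftrightarrow> v = f u \<and> f u \<noteq> u"
  by (auto simp: successor_graph_def)

lemma pair_digraph_successor_graph: "pair_digraph (successor_graph (f :: 'v::finite \<Rightarrow> 'v))"
  by unfold_locales (auto simp: successor_graph_def)

lemma inj_successor_graph: "inj successor_graph"
proof (rule injI)
  fix f g :: "'v \<Rightarrow> 'v"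
  assume "successor_graph f = successor_graph g"
  then have arcs: "(u, v) \<in> parcs (successor_graph f) \<longleftrightarrow> (u, v) \<in> parcs (successor_graph g)" for u v
    by simp
  have "f u = g u" for u
    using arcs[of u "f u"] arcs[of u "g u"] by (auto simp: successor_graph_simps)
  then show "f = g" ..
qed

lemma reachable_sink: "(v, sink f v) \<in> (parcs (successor_graph f))\<^sup>*"
proof -
  have "(v, (f ^^ k) v) \<in> (parcs (successor_graph f))\<^sup>*" for k
  proof (induction k)
    case (Suc k)
    then show ?case
      by (cases "f ((f ^^ k) v) = (f ^^ k) v")
        (auto simp: successor_graph_simps intro: rtrancl_into_rtrancl)
  qed simp
  then show ?thesis
    by (simp add: sink_def)
qed

text \<open>
  The sink is constant along arcs, and each vertex is joined to its sink.
\<close>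
lemma weakly_reachable_iff_same_sink:
  assumes "eventually_fixed f"
  defines "E \<equiv> parcs (successor_graph f)"
  shows "(u, v) \<in> (E \<union> E\<inverse>)\<^sup>* \<longleftrightarrow> sink f u = sink f v"
proof
  assume "(u, v) \<in> (E \<union> E\<inverse>)\<^sup>*"
  then show "sink f u = sink f v"
    by (induction rule: rtrancl_induct)
      (auto simp: E_def successor_graph_simps sink_step[OF assms(1)])
next
  assume eq: "sink f u = sink f v"
  have to: "(x, sink f x) \<in> (E \<union> E\<inverse>)\<^sup>*" for x
    using reachable_sink[of x f] rtrancl_mono[of E "E \<union> E\<inverse>"] by (auto simp: E_def)
  have "(E \<union> E\<inverse>)\<inverse> = E \<union> E\<inverse>"
    by auto
  then have "(sink f v, v) \<in> (E \<union> E\<inverse>)\<^sup>*"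
    using to[of v] by (metis rtrancl_converseI)
  then show "(u, v) \<in> (E \<union> E\<inverse>)\<^sup>*"
    using to[of u] eq by auto
qed

lemma component_of_successor_graph:
  assumes "eventually_fixed f"
  shows "pverts (component_of (successor_graph f) u) = {v. sink f v = sink f u}"
    and "(v, w) \<in> parcs (component_of (successor_graph f) u) \<longleftrightarrow>
      sink f v = sink f u \<and> w = f v \<and> f v \<noteq> v"
  by (auto simp: component_of_simps weakly_reachable_iff_same_sink[OF assms] successor_graph_simps)

lemma component_of_sink:
  assumes "eventually_fixed f"
  shows "component_of (successor_graph f) (sink f u) = component_of (successor_graph f) u"
  by (simp add: component_of_def weakly_reachable_iff_same_sink[OF assms]
      sink_of_fixed sink_fixed[OF assms])

text \<open>
  Each weak component contains exactly one fixed point, the common sink of its vertices, so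
  components can be indexed by roots.
\<close>
lemma weak_components_successor_graph:
  fixes f :: "'v::finite \<Rightarrow> 'v"
  assumes "eventually_fixed f"
  shows "bij_betw (component_of (successor_graph f)) {r. f r = r} (weak_components (successor_graph f))"
proof (rule bij_betw_imageI)
  show "inj_on (component_of (successor_graph f)) {r. f r = r}"
  proof (rule inj_onI)
    fix r s
    assume r: "r \<in> {r. f r = r}" and s: "s \<in> {r. f r = r}"
      and eq: "component_of (successor_graph f) r = component_of (successor_graph f) s"
    have "r \<in> pverts (component_of (successor_graph f) s)"
      using self_in_component_of[of r] by (simp flip: eq)
    then have "sink f r = sink f s"
      by (simp add: component_of_successor_graph(1)[OF assms])
    then show "r = s"
      using r s by (simp add: sink_of_fixed)
  qed
  have "pair_wf_digraph (successor_graph f)"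
    using pair_digraph_successor_graph pair_digraph.axioms pair_fin_digraph.axioms by blast
  then have "weak_components (successor_graph f) = range (component_of (successor_graph f))"
    by (simp add: weak_components_eq successor_graph_simps)
  also have "\<dots> = component_of (successor_graph f) ` {r. f r = r}"
    using component_of_sink[OF assms] sink_fixed[OF assms]
    by (auto simp: image_iff) metis
  finally show "component_of (successor_graph f) ` {r. f r = r} = weak_components (successor_graph f)" ..
qed

text \<open>
  When at most one arc leaves each vertex and none leaves \<open>r\<close>, a walk to
  \<open>r\<close> has a choice neither in where to go nor in where to stop.
\<close>
lemma pcas_to_sink_unique:
  assumes "pcas v p r" "set p \<subseteq> E" "pcas v q r" "set q \<subseteq> E"
    and "single_valued E" "\<And>z. (r, z) \<notin> E"
  shows "p = q"
  using assms(1-4)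
proof (induction p arbitrary: v q)
  case Nil
  then show ?case
    using assms(6) by (cases q) auto
next
  case (Cons e p)
  then obtain e' q' where q: "q = e' # q'"
    using assms(6) by (cases q) (auto, metis prod.collapse)
  have "snd e = snd e'"
    using Cons.prems assms(5) unfolding q single_valued_def
    by (metis list.set_intros(1) pcas.simps(2) prod.collapse subsetD)
  then have "e = e'"
    using Cons.prems q by (simp add: prod_eq_iff)
  moreover have "p = q'"
    using Cons.prems q \<open>e = e'\<close> by (intro Cons.IH) auto
  ultimately show ?case
    by (simp add: q)
qed

lemma is_rootD:
  assumes "is_root T r"
  shows "r \<in> pverts T" "v \<in> pverts T \<Longrightarrow> \<exists>!p. pre_digraph.apath (with_proj T) v p r"
  using assms by (simp_all add: is_root_def)

text \<open>
  Each vertex of the component walks down to its sink \<open>r\<close>, in a unique way; no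
  other vertex is a root, because \<open>r\<close> itself has no outgoing arc and reaches only
  itself.
\<close>
lemma is_root_component_of_successor_graph:
  fixes f :: "'v::finite \<Rightarrow> 'v"
  assumes ef: "eventually_fixed f" and r: "f r = r"
  shows "is_root (component_of (successor_graph f) r) r' \<longleftrightarrow> r' = r"
proof -
  let ?C = "component_of (successor_graph f) r"
  have "pair_wf_digraph (successor_graph f)"
    using pair_digraph_successor_graph pair_digraph.axioms pair_fin_digraph.axioms by blast
  interpret C: pair_wf_digraph ?C
    by unfold_locales (auto simp: component_of_successor_graph[OF ef] sink_step[OF ef])
  have sv: "single_valued (parcs ?C)"
    by (auto simp: single_valued_def component_of_successor_graph[OF ef])
  have no_out: "(r, z) \<notin> parcs ?C" for z
    by (simp add: component_of_successor_graph[OF ef] r)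
  have reach: "v \<rightarrow>\<^sup>*\<^bsub>with_proj ?C\<^esub> r" if "v \<in> pverts ?C" for v
    using that
  proof (induction "depth f v" arbitrary: v rule: less_induct)
    case less
    show ?case
    proof (cases "f v = v")
      case True
      then have "v = r"
        using less.prems by (simp add: component_of_successor_graph[OF ef] sink_of_fixed r)
      then show ?thesis
        using less.prems by simp
    next
      case False
      then have arc: "(v, f v) \<in> parcs ?C"
        using less.prems by (simp add: component_of_successor_graph[OF ef])
      have "f v \<rightarrow>\<^sup>*\<^bsub>with_proj ?C\<^esub> r"
        using C.in_arcsD2[OF arc] depth_step[OF ef False] by (intro less.hyps) auto
      then show ?thesis
        using C.adj_reachable_trans[of v "f v" r] arc by simp
    qed
  qed
  have root: "is_root ?C r"
    unfolding is_root_def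
  proof (intro conjI ballI)
    show "r \<in> pverts ?C"
      by (rule self_in_component_of)
  next
    fix v assume "v \<in> pverts ?C"
    then obtain p where "C.apath v p r"
      using reach C.reachable_apath by blast
    moreover have "p = q" if "C.apath v p r" "C.apath v q r" for p q
      using that by (intro pcas_to_sink_unique[OF _ _ _ _ sv no_out])
        (auto simp: C.apath_def C.awalk_def)
    ultimately show "\<exists>!p. C.apath v p r"
      by blast
  qed
  have "r' = r" if r': "is_root ?C r'"
  proof -
    obtain p where p: "C.apath r p r'"
      using is_rootD(2)[OF r' self_in_component_of] by (elim ex1E)
    show ?thesis
    proof (cases p)
      case Nil
      with p show ?thesis
        by (simp add: C.apath_Nil_iff)
    next
      case (Cons e q)
      with p have "e \<in> parcs ?C" "fst e = r"
        by (simp_all add: C.apath_Cons_iff)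
      then have "(r, snd e) \<in> parcs ?C"
        by (metis prod.collapse)
      then show ?thesis
        using no_out by blast
    qed
  qed
  then show ?thesis
    using root by blast
qed

lemma root_of_component_of_successor_graph:
  fixes f :: "'v::finite \<Rightarrow> 'v"
  assumes "eventually_fixed f" "f r = r"
  shows "root_of (component_of (successor_graph f) r) = r"
  by (simp add: root_of_def is_root_component_of_successor_graph[OF assms])

section \<open>Undirected and directed cycles\<close>

lemma pcas_nth_Suc: "pcas u c v \<Longrightarrow> Suc i < length c \<Longrightarrow> fst (c ! Suc i) = snd (c ! i)"
proof (induction c arbitrary: u i)
  case (Cons e c)
  then show ?case
    by (cases i; cases c) auto
qed simp

lemma pcas_ends: "pcas u c v \<Longrightarrow> c \<noteq> [] \<Longrightarrow> fst (c ! 0) = u \<and> snd (c ! (length c - 1)) = v"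
proof (induction c arbitrary: u)
  case (Cons e c)
  then show ?case
    by (cases c) auto
qed simp

lemma pawalk_verts_eq: "pcas u c v \<Longrightarrow> pawalk_verts u c = u # map snd c"
  by (induction c arbitrary: u) auto

text \<open>
  On an undirected cycle, consider a vertex of maximal depth. Its two neighbours are not
  deeper, so both are its image under \<open>f\<close>. They are thus equal, whereas on a
  cycle of length at least 3 they are distinct.
\<close>
lemma undirected_acyclic_successor_graph:
  fixes f :: "'v::finite \<Rightarrow> 'v"
  assumes ef: "eventually_fixed f"
  shows "undirected_acyclic (successor_graph f)"
  unfolding undirected_acyclic_def
proof (intro conjI notI allI impI)
  fix u v
  assume "(u, v) \<in> parcs (successor_graph f)" "(v, u) \<in> parcs (successor_graph f)"
  then have "v = f u" "f u \<noteq> u" "u = f v" "f v \<noteq> v"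
    by (auto simp: successor_graph_simps)
  then show False
    using depth_step[OF ef, of u] depth_step[OF ef, of v] by simp
next
  let ?S = "mk_symmetric (with_proj (successor_graph f))"
  assume "\<exists>c. pre_digraph.cycle (with_proj ?S) c \<and> 3 \<le> length c"
  then obtain c u where c: "pcas u c u" "set c \<subseteq> parcs ?S" "distinct (map snd c)" "3 \<le> length c"
    by (auto simp: pre_digraph.cycle_def pre_digraph.awalk_def cas_with_proj_eq
        awalk_verts_with_proj_eq pawalk_verts_eq)
  define n where "n = length c"
  \<comment> \<open>The cyclic successor of a position; the vertices of the cycle are the heads of its arcs.\<close>
  define \<sigma> where "\<sigma> i = (if Suc i = n then 0 else Suc i)" for i
  have \<sigma>: "\<sigma> i < n" if "i < n" for i
    using that by (auto simp: \<sigma>_def)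
  have link: "fst (c ! \<sigma> i) = snd (c ! i)" if "i < n" for i
  proof (cases "Suc i = n")
    case True
    then have "i = length c - 1" "c \<noteq> []"
      by (auto simp: n_def)
    moreover have "\<sigma> i = 0"
      using True by (simp add: \<sigma>_def)
    ultimately show ?thesis
      using pcas_ends[OF c(1)] by simp
  next
    case False
    then show ?thesis
      using that pcas_nth_Suc[OF c(1), of i] by (simp add: \<sigma>_def n_def)
  qed
  have arc: "(fst (c ! i) = f (snd (c ! i)) \<or> snd (c ! i) = f (fst (c ! i))) \<and> fst (c ! i) \<noteq> snd (c ! i)"
    if "i < n" for i
  proof -
    have "(fst (c ! i), snd (c ! i)) \<in> parcs ?S"
      using c(2) that by (auto simp: n_def)
    then show ?thesis
      by (auto simp: parcs_mk_symmetric successor_graph_def)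
  qed
  let ?d = "\<lambda>i. depth f (snd (c ! i))"
  obtain j where j: "j < n" "\<And>i. i < n \<Longrightarrow> ?d i \<le> ?d j"
  proof -
    have "finite {..<n}" "0 \<in> {..<n}"
      using c(4) by (auto simp: n_def)
    then have "finite (?d ` {..<n})" "?d ` {..<n} \<noteq> {}"
      by blast+
    then have "Max (?d ` {..<n}) \<in> ?d ` {..<n}"
      by (rule Max_in)
    then obtain j where "j \<in> {..<n}" "Max (?d ` {..<n}) = ?d j"
      by (elim imageE)
    moreover have "?d i \<le> Max (?d ` {..<n})" if "i < n" for i
      using that by (intro Max_ge) auto
    ultimately show ?thesis
      using that[of j] by simp
  qed
  define i where "i = (if j = 0 then n - 1 else j - 1)"
  have i: "i < n" "\<sigma> i = j"
    using j(1) by (auto simp: i_def \<sigma>_def)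
  let ?x = "snd (c ! j)"
  have deepest: "y = f ?x" if "y = f ?x \<or> ?x = f y" "y \<noteq> ?x" "depth f y \<le> depth f ?x" for y
    using that depth_step[OF ef, of y] by auto
  have "snd (c ! i) = f ?x"
    using deepest[of "snd (c ! i)"] arc[OF j(1)] link[OF i(1)] i j(2)[OF i(1)] by auto
  moreover have "snd (c ! \<sigma> j) = f ?x"
    using deepest[of "snd (c ! \<sigma> j)"] arc[OF \<sigma>[OF j(1)]] link[OF j(1)] j(2)[OF \<sigma>[OF j(1)]] by auto
  ultimately have "i = \<sigma> j"
    using c(3) i(1) \<sigma>[OF j(1)] by (simp add: distinct_conv_nth n_def) metis
  then show False
    using c(4) j(1) by (auto simp: i_def \<sigma>_def n_def split: if_splits)
qed

text \<open>
  A directed cycle has length at least 2, as there are no loops. Length 2 means a pair of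
  opposite arcs, and a longer cycle is a cycle of the symmetrization.
\<close>
lemma undirected_acyclic_imp_acyclic:
  assumes "pair_digraph F" "undirected_acyclic F"
  shows "acyclic (parcs F)"
proof (rule acyclicI, intro allI notI)
  interpret F: pair_digraph F by fact
  fix x assume "(x, x) \<in> (parcs F)\<^sup>+"
  then obtain p where "F.awalk x p x" "p \<noteq> []"
    using F.reachable1_awalk by auto
  then have "F.closed_w p"
    by (auto simp: F.closed_w_def)
  then obtain c where c: "F.cycle c"
    using F.closed_w_imp_cycle by blast
  then obtain u where u: "pcas u c u" "set c \<subseteq> parcs F" "c \<noteq> []"
    by (auto simp: F.cycle_def F.awalk_def)
  have "length c \<noteq> 1"
    using u F.pair_no_loops by (fastforce simp: length_Suc_conv)
  moreover have "length c \<noteq> 2"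
    using u assms(2) by (auto simp: undirected_acyclic_def length_Suc_conv numeral_2_eq_2)
  moreover have "length c \<noteq> 0"
    using u by simp
  ultimately have len: "3 \<le> length c"
    by linarith
  interpret S: pair_wf_digraph "mk_symmetric (with_proj F)"
    by (rule F.wellformed_mk_symmetric)
  have "subgraph (with_proj F) (with_proj (mk_symmetric (with_proj F)))"
    by (rule subgraphI) (auto simp: parcs_mk_symmetric F.wf_digraph S.wf_digraph)
  then have "S.cycle c"
    using S.subgraph_cycle c by blast
  then show False
    using assms(2) len by (auto simp: undirected_acyclic_def)
qed

section \<open>Spanning rooted forests as eventually fixed functions\<close>

text \<open>
  Two different arcs out of \<open>u\<close> would extend to two different paths from
  \<open>u\<close> to the root of its component: neither extension revisits \<open>u\<close>,
  since that would close a directed cycle. So each vertex has at most one outgoing arc.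
  Following these arcs one reaches the root, which has no outgoing arc, as such an arc would
  again close a directed cycle.
\<close>
lemma rooted_forest_is_successor_graph:
  fixes F :: "'v::finite pair_pre_digraph"
  assumes forest: "rooted_forest k F" and UNIV: "pverts F = UNIV"
  obtains f where "eventually_fixed f" "F = successor_graph f"
proof -
  interpret F: pair_digraph F
    using forest by (simp add: rooted_forest_def)
  have wf: "pair_wf_digraph F"
    by unfold_locales
  have acyclic: "(x, x) \<notin> (parcs F)\<^sup>+" for x
    using undirected_acyclic_imp_acyclic[of F] forest by (auto simp: rooted_forest_def acyclic_def)
  have wfC: "pair_wf_digraph (component_of F u)" for u
    by unfold_locales (auto simp: component_of_simps intro: rtrancl_into_rtrancl)
  have "\<exists>r. is_root (component_of F u) r" for u
    using forest weak_components_eq[OF wf] by (simp add: rooted_forest_def UNIV)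
  then obtain \<rho> where \<rho>: "\<And>u. is_root (component_of F u) (\<rho> u)"
    by metis
  have "single_valued (parcs F)"
  proof (rule single_valuedI)
    fix u v w
    assume uv: "(u, v) \<in> parcs F" and uw: "(u, w) \<in> parcs F"
    let ?C = "component_of F u"
    interpret C: pair_wf_digraph ?C by (rule wfC)
    have path: "\<exists>p. C.apath u ((u, z) # p) (\<rho> u)" if uz: "(u, z) \<in> parcs F" for z
    proof -
      have arc: "(u, z) \<in> parcs ?C" and z: "z \<in> pverts ?C"
        using component_of_arc[OF self_in_component_of uz] by auto
      obtain p where p: "C.apath z p (\<rho> u)"
        using is_rootD(2)[OF \<rho> z] by (elim ex1E)
      have "u \<notin> set (pawalk_verts z p)"
      proof
        assume "u \<in> set (pawalk_verts z p)"
        then have "z \<rightarrow>\<^sup>*\<^bsub>with_proj ?C\<^esub> u"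
          using p C.awalk_verts_reachable_from by (auto simp: C.apath_def)
        then have "(z, u) \<in> (parcs ?C)\<^sup>*"
          using C.reachable_conv' by auto
        then have "(z, u) \<in> (parcs F)\<^sup>*"
          using rtrancl_mono[of "parcs ?C" "parcs F"] by (auto simp: component_of_simps)
        then show False
          using uz acyclic by (meson rtrancl_into_trancl2)
      qed
      then have "C.apath u ((u, z) # p) (\<rho> u)"
        using p arc by (simp add: C.apath_Cons_iff)
      then show ?thesis ..
    qed
    have "\<exists>!p. C.apath u p (\<rho> u)"
      by (rule is_rootD(2)[OF \<rho> self_in_component_of])
    moreover obtain p where "C.apath u ((u, v) # p) (\<rho> u)"
      using path[OF uv] by (elim exE)
    moreover obtain q where "C.apath u ((u, w) # q) (\<rho> u)"
      using path[OF uw] by (elim exE)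
    ultimately have "(u, v) # p = (u, w) # q"
      by (metis (no_types, lifting))
    then show "v = w"
      by simp
  qed
  define f where "f u = (if \<exists>v. (u, v) \<in> parcs F then THE v. (u, v) \<in> parcs F else u)" for u
  have f_eq: "f u = v" if "(u, v) \<in> parcs F" for u v
    using that \<open>single_valued (parcs F)\<close> by (auto simp: f_def single_valued_def)
  have f_arc: "(u, f u) \<in> parcs F" if "f u \<noteq> u" for u
    using that f_eq by (metis f_def)
  have arcs: "(u, v) \<in> parcs F \<longleftrightarrow> v = f u \<and> f u \<noteq> u" for u v
    using f_eq f_arc F.pair_no_loops by fastforce
  have "F = successor_graph f"
    by (rule pair_pre_digraph.equality) (auto simp: UNIV successor_graph_simps arcs)
  moreover have "eventually_fixed f"
    unfolding eventually_fixed_def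
  proof
    fix v
    let ?C = "component_of F v"
    interpret C: pair_wf_digraph ?C by (rule wfC)
    have to_root: "(u, \<rho> v) \<in> (parcs F)\<^sup>*" if u: "u \<in> pverts ?C" for u
    proof -
      obtain p where "C.apath u p (\<rho> v)"
        using is_rootD(2)[OF \<rho> u] by (elim ex1E)
      then have "u \<rightarrow>\<^sup>*\<^bsub>with_proj ?C\<^esub> \<rho> v"
        using C.reachable_apath by blast
      then have "(u, \<rho> v) \<in> (parcs ?C)\<^sup>*"
        using C.reachable_conv' by auto
      then show ?thesis
        using rtrancl_mono[of "parcs ?C" "parcs F"] by (auto simp: component_of_simps)
    qed
    have "\<exists>k. \<rho> v = (f ^^ k) v"
      using to_root[OF self_in_component_of]
    proof (induction rule: rtrancl_induct)
      case base
      show ?case by (rule exI[of _ 0]) simp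
    next
      case (step y z)
      then obtain k where "y = (f ^^ k) v" "z = f y"
        by (auto simp: arcs)
      then show ?case
        by (intro exI[of _ "Suc k"]) simp
    qed
    moreover have "f (\<rho> v) = \<rho> v"
    proof (rule ccontr)
      assume ne: "f (\<rho> v) \<noteq> \<rho> v"
      have "\<rho> v \<in> pverts ?C"
        using \<rho>[of v] by (simp add: is_root_def)
      then have "(f (\<rho> v), \<rho> v) \<in> (parcs F)\<^sup>*"
        by (intro to_root component_of_arc(2)[OF _ f_arc[OF ne]])
      then show False
        using f_arc[OF ne] acyclic by (meson rtrancl_into_trancl2)
    qed
    ultimately show "\<exists>k. f ((f ^^ k) v) = (f ^^ k) v"
      by metis
  qed
  ultimately show ?thesis
    using that by blast
qed

lemma rooted_forest_successor_graph:
  fixes f :: "'v::finite \<Rightarrow> 'v"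
  assumes ef: "eventually_fixed f"
  shows "rooted_forest (card {r. f r = r}) (successor_graph f)"
proof -
  note bij = weak_components_successor_graph[OF ef]
  have "\<exists>r. is_root T r" if "T \<in> weak_components (successor_graph f)" for T
  proof -
    have "T \<in> component_of (successor_graph f) ` {r. f r = r}"
      using that by (simp add: bij_betw_imp_surj_on[OF bij])
    then obtain r where "f r = r" and T: "T = component_of (successor_graph f) r"
      by (elim imageE) simp
    then have "is_root T r"
      using is_root_component_of_successor_graph[OF ef] by simp
    then show ?thesis ..
  qed
  then show ?thesis
    using bij_betw_same_card[OF bij] undirected_acyclic_successor_graph[OF ef]
    by (simp add: rooted_forest_def pair_digraph_successor_graph)
qed

lemma spanning_rooted_forests_eq:
  fixes \<Gamma> :: "'v::finite pair_pre_digraph"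
  assumes "pair_wf_digraph \<Gamma>" "pverts \<Gamma> = UNIV"
  shows "spanning_rooted_forests \<Gamma> k = successor_graph `
    {f. eventually_fixed f \<and> card {r. f r = r} = k \<and> (\<forall>u. f u \<noteq> u \<longrightarrow> (u, f u) \<in> parcs \<Gamma>)}"
    (is "?L = successor_graph ` ?R")
proof (intro equalityI subsetI)
  fix F assume "F \<in> ?L"
  then have F: "spanning (with_proj F) (with_proj \<Gamma>)" and forest: "rooted_forest k F"
    by (auto simp: spanning_rooted_forests_def)
  then have UNIV: "pverts F = UNIV" and arcs: "parcs F \<subseteq> parcs \<Gamma>"
    using assms(2) by (auto simp: spanning_def subgraph_def)
  obtain f where ef: "eventually_fixed f" and Ff: "F = successor_graph f"
    using rooted_forest_is_successor_graph[OF forest UNIV] by blast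
  have "card {r. f r = r} = k"
    using forest rooted_forest_successor_graph[OF ef] by (simp add: Ff rooted_forest_def)
  then show "F \<in> successor_graph ` ?R"
    using ef arcs unfolding Ff by (intro imageI) (auto simp: successor_graph_simps)
next
  fix F assume "F \<in> successor_graph ` ?R"
  then obtain f where F: "F = successor_graph f" and ef: "eventually_fixed f"
    and k: "card {r. f r = r} = k" and arcs: "\<And>u. f u \<noteq> u \<Longrightarrow> (u, f u) \<in> parcs \<Gamma>"
    by auto
  interpret G: pair_wf_digraph \<Gamma> by fact
  interpret F: pair_digraph F
    unfolding F by (rule pair_digraph_successor_graph)
  have "subgraph (with_proj F) (with_proj \<Gamma>)"
    by (rule subgraphI)
      (auto simp: assms F successor_graph_simps arcs F.wf_digraph[unfolded F] G.wf_digraph)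
  then have "spanning (with_proj F) (with_proj \<Gamma>)"
    by (simp add: spanning_def assms F successor_graph_simps)
  then show "F \<in> ?L"
    using rooted_forest_successor_graph[OF ef] k by (simp add: spanning_rooted_forests_def F)
qed

lemma forest_weight_successor_graph:
  fixes f :: "'v::finite \<Rightarrow> 'v"
  shows "forest_weight \<omega> (successor_graph f) = (\<Prod>u | f u \<noteq> u. \<omega> (u, f u))"
proof -
  have "parcs (successor_graph f) = (\<lambda>u. (u, f u)) ` {u. f u \<noteq> u}"
    by (auto simp: successor_graph_def)
  then show ?thesis
    by (simp add: forest_weight_def prod.reindex inj_on_def)
qed

lemma prod_roots_successor_graph:
  fixes f :: "'v::finite \<Rightarrow> 'v" and d :: "'v \<Rightarrow> real"
  assumes ef: "eventually_fixed f"
  shows "(\<Prod>T\<in>weak_components (successor_graph f). d (root_of T)) = (\<Prod>r | f r = r. d r)"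
proof -
  have "(\<Prod>r | f r = r. d (root_of (component_of (successor_graph f) r)))
      = (\<Prod>T\<in>weak_components (successor_graph f). d (root_of T))"
    by (rule prod.reindex_bij_betw[OF weak_components_successor_graph[OF ef]])
  then show ?thesis
    by (simp add: root_of_component_of_successor_graph[OF ef])
qed

text \<open>
  The functions on the right may use pairs that are not arcs of \<open>\<Gamma>\<close>; they
  contribute 0 because these pairs have weight 0.
\<close>
lemma sum_spanning_rooted_forests:
  fixes \<Gamma> :: "'v::finite pair_pre_digraph" and d :: "'v \<Rightarrow> real"
  assumes "weighted_digraph \<Gamma> \<omega>"
  shows "(\<Sum>F\<in>spanning_rooted_forests \<Gamma> k. (\<Prod>T\<in>weak_components F. d (root_of T)) * forest_weight \<omega> F)
    = (\<Sum>f | eventually_fixed f \<and> card {r. f r = r} = k. \<Prod>u\<in>UNIV. if f u = u then d u else \<omega> (u, f u))"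
proof -
  interpret weighted_digraph \<Gamma> \<omega> by fact
  have wf: "pair_wf_digraph \<Gamma>" by unfold_locales
  let ?R = "{f. eventually_fixed f \<and> card {r. f r = r} = k \<and> (\<forall>u. f u \<noteq> u \<longrightarrow> (u, f u) \<in> parcs \<Gamma>)}"
  let ?t = "\<lambda>f. \<Prod>u\<in>UNIV. if f u = u then d u else \<omega> (u, f u)"
  have "(\<Sum>F\<in>spanning_rooted_forests \<Gamma> k. (\<Prod>T\<in>weak_components F. d (root_of T)) * forest_weight \<omega> F)
      = (\<Sum>f\<in>?R. (\<Prod>T\<in>weak_components (successor_graph f). d (root_of T)) * forest_weight \<omega> (successor_graph f))"
    unfolding spanning_rooted_forests_eq[OF wf pverts_eq_UNIV]
    by (subst sum.reindex) (auto intro: inj_on_subset[OF inj_successor_graph])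
  also have "\<dots> = (\<Sum>f\<in>?R. ?t f)"
  proof (intro sum.cong refl)
    fix f assume "f \<in> ?R"
    then have ef: "eventually_fixed f" by simp
    have "?t f = (\<Prod>u | f u = u. d u) * (\<Prod>u | f u \<noteq> u. \<omega> (u, f u))"
      by (simp add: prod.If_cases Collect_neg_eq)
    then show "(\<Prod>T\<in>weak_components (successor_graph f). d (root_of T)) * forest_weight \<omega> (successor_graph f)
        = ?t f"
      by (simp add: prod_roots_successor_graph[OF ef] forest_weight_successor_graph)
  qed
  also have "\<dots> = (\<Sum>f | eventually_fixed f \<and> card {r. f r = r} = k. ?t f)"
  proof (rule sum.mono_neutral_left)
    show "\<forall>f\<in>{f. eventually_fixed f \<and> card {r. f r = r} = k} - ?R. ?t f = 0"
    proof
      fix f assume "f \<in> {f. eventually_fixed f \<and> card {r. f r = r} = k} - ?R"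
      then obtain u where "f u \<noteq> u" "(u, f u) \<notin> parcs \<Gamma>"
        by auto
      then show "?t f = 0"
        by (intro prod_zero bexI[of _ u]) (auto simp: weight_zero)
    qed
  qed auto
  finally show ?thesis .
qed

text \<open>
  A spanning rooted tree is its own only weak component, so its root is the root of that
  component.
\<close>
lemma rooted_tree_weight_sum:
  fixes \<Gamma> :: "'v::finite pair_pre_digraph" and d :: "'v \<Rightarrow> real"
  assumes "weighted_digraph \<Gamma> \<omega>"
  shows "(\<Sum>w\<in>UNIV. d w * rooted_tree_weight \<Gamma> \<omega> w)
    = (\<Sum>F\<in>spanning_rooted_forests \<Gamma> 1. (\<Prod>T\<in>weak_components F. d (root_of T)) * forest_weight \<omega> F)"
proof -
  interpret weighted_digraph \<Gamma> \<omega> by fact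
  have wf: "pair_wf_digraph \<Gamma>" by unfold_locales
  let ?S = "spanning_rooted_forests \<Gamma> 1"
  have fin: "finite ?S"
    unfolding spanning_rooted_forests_eq[OF wf pverts_eq_UNIV] by (rule finite_imageI) simp
  have "(\<Sum>w\<in>UNIV. d w * rooted_tree_weight \<Gamma> \<omega> w)
      = (\<Sum>w\<in>UNIV. \<Sum>T | T \<in> ?S \<and> root_of T = w. d (root_of T) * forest_weight \<omega> T)"
    by (simp add: rooted_tree_weight_def sum_distrib_left)
  also have "\<dots> = (\<Sum>T\<in>?S. d (root_of T) * forest_weight \<omega> T)"
    by (rule sum.group[OF fin]) auto
  also have "\<dots> = (\<Sum>F\<in>?S. (\<Prod>T\<in>weak_components F. d (root_of T)) * forest_weight \<omega> F)"
  proof (intro sum.cong refl)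
    fix F assume "F \<in> ?S"
    then obtain f where F: "F = successor_graph f" and ef: "eventually_fixed f" and one: "card {r. f r = r} = 1"
      unfolding spanning_rooted_forests_eq[OF wf pverts_eq_UNIV] by blast
    obtain r where r: "{r. f r = r} = {r}"
      using one by (auto simp: card_1_singleton_iff)
    then have fr: "f r = r"
      by blast
    have "sink f v = r" for v
      using r sink_fixed[OF ef, of v] by blast
    then have "component_of F r = F"
      by (intro pair_pre_digraph.equality)
        (auto simp: F component_of_successor_graph[OF ef] successor_graph_simps)
    then have "root_of F = r"
      using root_of_component_of_successor_graph[OF ef fr] by (simp add: F)
    then show "d (root_of F) * forest_weight \<omega> F = (\<Prod>T\<in>weak_components F. d (root_of T)) * forest_weight \<omega> F"
      by (simp add: F prod_roots_successor_graph[OF ef] r)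
  qed
  finally show ?thesis .
qed

section \<open>The normalized Laplacian of a strongly connected digraph\<close>

locale strongly_connected_weighted_digraph = weighted_digraph \<Gamma> \<omega>
  for \<Gamma> :: "'v::finite pair_pre_digraph" and \<omega> :: "'v \<times> 'v \<Rightarrow> real" +
  assumes strongly_connected_\<Gamma>: "strongly_connected (with_proj \<Gamma>)"
begin

abbreviation d :: "'v \<Rightarrow> real" where
  "d \<equiv> out_weight \<omega>"

abbreviation P :: "real^'v^'v" where
  "P \<equiv> transition_matrix \<omega>"

abbreviation \<pi> :: "real^'v" where
  "\<pi> \<equiv> stationary_distribution \<omega>"

lemma weight_nonneg: "\<omega> e \<ge> 0"
  using weight_pos[of e] weight_zero[of e] by fastforce

lemma arcs_connect: "(u, v) \<in> (parcs \<Gamma>)\<^sup>*"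
proof -
  have "u \<rightarrow>\<^sup>*\<^bsub>with_proj \<Gamma>\<^esub> v"
    using strongly_connected_\<Gamma> by (auto simp: strongly_connected_def pverts_eq_UNIV)
  then show ?thesis
    by (simp add: reachable_conv' pverts_eq_UNIV)
qed

text \<open>
  There is a second vertex, and a path to it leaves \<open>u\<close> along some arc.
\<close>
lemma out_weight_pos: "d u > 0"
proof -
  have "\<exists>v. v \<noteq> u"
  proof (rule ccontr)
    assume "\<not> ?thesis"
    then have "(UNIV :: 'v set) = {u}"
      by auto
    then have "CARD('v) = card {u}"
      by simp
    then show False
      using at_least_two_vertices by simp
  qed
  then obtain v where "v \<noteq> u" ..
  then obtain w where "(u, w) \<in> parcs \<Gamma>"
    using arcs_connect[of u v] by (auto elim: converse_rtranclE)
  then have "\<omega> (u, w) > 0"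
    by (rule weight_pos)
  then show ?thesis
    unfolding out_weight_def by (intro sum_pos2[of _ w]) (auto simp: weight_nonneg)
qed

lemma transition_matrix_entry: "P $ u $ v = \<omega> (u, v) / d u"
  using out_weight_pos
  by (subst transition_matrix_def, subst matrix_inv_diag_matrix)
    (auto simp: diag_matrix_mult_left adjacency_matrix_def less_imp_neq[symmetric])

lemma transition_matrix_nonneg: "P $ u $ v \<ge> 0"
  using out_weight_pos[of u] by (simp add: transition_matrix_entry weight_nonneg)

lemma transition_matrix_rows: "(\<Sum>v\<in>UNIV. P $ u $ v) = 1"
  using out_weight_pos[of u]
  by (simp add: transition_matrix_entry sum_divide_distrib[symmetric] flip: out_weight_def)

lemma transition_matrix_irreducible: "(u, v) \<in> {(a, b). P $ a $ b > 0}\<^sup>*"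
proof -
  have "parcs \<Gamma> \<subseteq> {(a, b). P $ a $ b > 0}"
    using out_weight_pos by (auto simp: transition_matrix_entry weight_pos)
  then show ?thesis
    using arcs_connect rtrancl_mono by blast
qed

lemmas transition_matrix_irreducible_stochastic =
  transition_matrix_nonneg transition_matrix_rows transition_matrix_irreducible

lemma is_stationary_distribution_\<pi>: "is_stationary_distribution P \<pi>"
proof -
  obtain p where p: "is_stationary_distribution P p"
    using stationary_distribution_exists[OF transition_matrix_irreducible_stochastic] by (elim exE)
  then have "\<pi> = p"
    unfolding stationary_distribution_def
    by (rule the_equality) (rule stationary_distribution_unique[OF transition_matrix_irreducible_stochastic _ p])
  then show ?thesis
    using p by simp
qed

lemma stationary_distribution_pos: "\<pi> $ u > 0"
  and stationary_distribution_sum: "(\<Sum>u\<in>UNIV. \<pi> $ u) = 1"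
  and stationary_distribution_invariant: "\<pi> v* P = \<pi>"
  using is_stationary_distribution_\<pi> by (auto simp: is_stationary_distribution_def)

abbreviation N :: "real^'v^'v" where
  "N \<equiv> normalized_laplacian \<omega>"

definition sqrt_pi :: "'v \<Rightarrow> real" where
  "sqrt_pi u = sqrt (\<pi> $ u)"

lemma sqrt_pi_pos: "sqrt_pi u > 0"
  using stationary_distribution_pos by (simp add: sqrt_pi_def)

lemma sqrt_pi_square: "sqrt_pi u * sqrt_pi u = \<pi> $ u"
  using stationary_distribution_pos[of u] by (simp add: sqrt_pi_def)

text \<open>
  The orthogonal projection onto the line spanned by the entrywise square root of the
  stationary distribution, which is the common kernel of the normalized Laplacian and its
  transpose.
\<close>
definition kernel_proj :: "real^'v^'v" where
  "kernel_proj = (\<chi> u v. sqrt_pi u * sqrt_pi v)"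

lemma normalized_laplacian_eq:
  "N = diag_matrix sqrt_pi ** (mat 1 - P) ** diag_matrix (\<lambda>u. 1 / sqrt_pi u)"
proof -
  have "sqrt_stationary_matrix \<omega> = diag_matrix sqrt_pi"
    by (simp add: sqrt_stationary_matrix_def sqrt_pi_def[abs_def])
  moreover have "matrix_inv (diag_matrix sqrt_pi) = diag_matrix (\<lambda>u. 1 / sqrt_pi u)"
    using sqrt_pi_pos by (intro matrix_inv_diag_matrix) (simp add: less_imp_neq[symmetric])
  ultimately show ?thesis
    by (simp add: normalized_laplacian_def)
qed

lemma normalized_laplacian_entry: "N $ u $ v = sqrt_pi u * (mat 1 - P) $ u $ v / sqrt_pi v"
  by (simp only: normalized_laplacian_eq diag_matrix_mult_right diag_matrix_mult_left) simp

lemma laplacian_rows: "(\<Sum>v\<in>UNIV. (mat 1 - P) $ u $ v) = 0"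
  by (simp add: sum_subtractf transition_matrix_rows mat_def)

lemma laplacian_stationary: "(\<Sum>u\<in>UNIV. \<pi> $ u * (mat 1 - P) $ u $ v) = 0"
proof -
  have "(\<Sum>u\<in>UNIV. \<pi> $ u * (mat 1 - P) $ u $ v) = (\<pi> v* (mat 1 - P)) $ v"
    by (simp add: vector_matrix_mult_def mult.commute)
  also have "\<dots> = 0"
    by (simp add: vector_matrix_mult_diff_rdistrib stationary_distribution_invariant)
  finally show ?thesis .
qed

lemma normalized_laplacian_kernel_proj: "N ** kernel_proj = 0"
proof -
  have "(\<Sum>k\<in>UNIV. N $ u $ k * kernel_proj $ k $ v) = sqrt_pi u * sqrt_pi v * (\<Sum>k\<in>UNIV. (mat 1 - P) $ u $ k)" for u v
    unfolding sum_distrib_left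
    by (intro sum.cong refl)
      (simp add: normalized_laplacian_entry kernel_proj_def less_imp_neq[OF sqrt_pi_pos, symmetric] del: vector_minus_component)
  then show ?thesis
    by (simp add: vec_eq_iff matrix_matrix_mult_def laplacian_rows del: vector_minus_component)
qed

lemma kernel_proj_normalized_laplacian: "kernel_proj ** N = 0"
proof -
  have "(\<Sum>k\<in>UNIV. kernel_proj $ u $ k * N $ k $ v) = sqrt_pi u / sqrt_pi v * (\<Sum>k\<in>UNIV. \<pi> $ k * (mat 1 - P) $ k $ v)" for u v
    unfolding sum_distrib_left
    by (intro sum.cong refl)
      (simp add: normalized_laplacian_entry kernel_proj_def sqrt_pi_square[symmetric] mult_ac del: vector_minus_component)
  then show ?thesis
    by (simp add: vec_eq_iff matrix_matrix_mult_def laplacian_stationary del: vector_minus_component)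
qed

lemma kernel_proj_idem: "kernel_proj ** kernel_proj = kernel_proj"
proof -
  have "(\<Sum>k\<in>UNIV. kernel_proj $ u $ k * kernel_proj $ k $ v) = sqrt_pi u * sqrt_pi v * (\<Sum>k\<in>UNIV. \<pi> $ k)" for u v
    unfolding sum_distrib_left
    by (intro sum.cong refl) (simp add: kernel_proj_def sqrt_pi_square[symmetric] mult_ac)
  then show ?thesis
    by (simp add: vec_eq_iff matrix_matrix_mult_def stationary_distribution_sum kernel_proj_def)
qed

lemma trace_kernel_proj: "trace kernel_proj = 1"
  by (simp add: trace_def kernel_proj_def sqrt_pi_square stationary_distribution_sum)

lemma transpose_kernel_proj: "transpose kernel_proj = kernel_proj"
  by (simp add: kernel_proj_def transpose_def vec_eq_iff mult.commute)

text \<open>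
  A left kernel vector \<open>y\<close> of the sum is annihilated by both summands, as
  multiplication by the projection from the right shows. Scaling \<open>y\<close> by the
  square roots turns the first condition into stationarity and the second into total 0, so
  \<open>stationary_sum_zero\<close> applies.
\<close>
lemma invertible_normalized_laplacian_plus_kernel_proj: "invertible (N + kernel_proj)"
proof -
  have "y = 0" if y: "transpose (N + kernel_proj) *v y = 0" for y
  proof -
    have yNJ: "y v* (N + kernel_proj) = 0"
      using y by (simp add: transpose_matrix_vector)
    have "y v* kernel_proj = (y v* (N + kernel_proj)) v* kernel_proj"
      by (simp add: vector_matrix_mul_assoc matrix_add_rdistrib normalized_laplacian_kernel_proj kernel_proj_idem)
    then have yJ: "y v* kernel_proj = 0"
      using yNJ by (simp add: vector_matrix_mult_def vec_eq_iff)
    then have yN: "y v* N = 0"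
      using yNJ by (simp add: vector_matrix_mult_add_rdistrib)
    define r where "r = (\<chi> u. y $ u * sqrt_pi u)"
    have sum_r: "(\<Sum>u\<in>UNIV. r $ u) = 0"
    proof -
      fix v
      have "(y v* kernel_proj) $ v = sqrt_pi v * (\<Sum>u\<in>UNIV. r $ u)"
        unfolding sum_distrib_left by (simp add: vector_matrix_mult_def kernel_proj_def r_def mult_ac)
      then show ?thesis
        using yJ sqrt_pi_pos[of v] by simp
    qed
    have "(r v* (mat 1 - P)) $ v = 0" for v
    proof -
      have "(r v* (mat 1 - P)) $ v = sqrt_pi v * (y v* N) $ v"
        unfolding vector_matrix_mult_def vec_lambda_beta sum_distrib_left
        by (intro sum.cong refl)
          (simp add: normalized_laplacian_entry r_def less_imp_neq[OF sqrt_pi_pos, symmetric] mult_ac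
            del: vector_minus_component)
      then show ?thesis
        using yN by simp
    qed
    then have "r v* (mat 1 - P) = 0"
      by (simp add: vec_eq_iff)
    then have "r v* P = r"
      by (simp add: vector_matrix_mult_diff_rdistrib)
    then have "r = 0"
      using sum_r by (rule stationary_sum_zero[OF transition_matrix_irreducible_stochastic])
    then show "y = 0"
      using sqrt_pi_pos by (simp add: r_def vec_eq_iff less_imp_neq[symmetric])
  qed
  then have "invertible (transpose (N + kernel_proj))"
    using matrix_left_invertible_ker invertible_left_inverse by blast
  then show ?thesis
    using transpose_invertible[of "transpose (N + kernel_proj)"] by simp
qed

definition choice_weight :: "('v \<Rightarrow> 'v) \<Rightarrow> real" where
  "choice_weight f = (\<Prod>u\<in>UNIV. if f u = u then d u else \<omega> (u, f u))"

text \<open>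
  Conjugation by the square roots of \<open>\<pi>\<close> does not change the determinant, and
  multiplying \<open>x + 1 - P\<close> by the degree matrix gives the matrix of the matrix
  forest theorem with \<open>x * d u\<close> on the diagonal.
\<close>
lemma det_normalized_laplacian:
  "det (mat x + N) = (\<Sum>f | eventually_fixed f. choice_weight f / (\<Prod>u\<in>UNIV. d u) * x ^ card {r. f r = r})"
proof -
  have loopless: "\<omega> (u, u) = 0" for u
    using pair_no_loops by (intro weight_zero) fastforce
  have inverse: "diag_matrix sqrt_pi ** diag_matrix (\<lambda>u. 1 / sqrt_pi u) = mat 1"
    by (simp add: diag_matrix_mult less_imp_neq[OF sqrt_pi_pos, symmetric] diag_matrix_one)
  have "diag_matrix sqrt_pi ** mat x ** diag_matrix (\<lambda>u. 1 / sqrt_pi u) = mat x"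
    by (simp add: mat_mult_right scalar_matrix_assoc[symmetric] inverse)
      (simp add: vec_eq_iff mat_def)
  then have "mat x + N = diag_matrix sqrt_pi ** (mat x + (mat 1 - P)) ** diag_matrix (\<lambda>u. 1 / sqrt_pi u)"
    by (simp add: normalized_laplacian_eq matrix_add_ldistrib matrix_add_rdistrib)
  then have "det (mat x + N) = det (mat x + (mat 1 - P)) * det (diag_matrix sqrt_pi ** diag_matrix (\<lambda>u. 1 / sqrt_pi u))"
    by (simp add: det_mul)
  then have similar: "det (mat x + N) = det (mat x + (mat 1 - P))"
    by (simp add: inverse)
  have "diag_matrix d ** (mat x + (mat 1 - P))
      = (\<chi> u v. (if u = v then x * d u + (\<Sum>z\<in>UNIV. \<omega> (u, z)) else 0) - \<omega> (u, v))"
    using out_weight_pos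
    by (auto simp: vec_eq_iff diag_matrix_mult_left transition_matrix_entry mat_def
        out_weight_def[symmetric] less_imp_neq[symmetric] algebra_simps)
  then have "(\<Prod>u\<in>UNIV. d u) * det (mat x + N)
      = (\<Sum>f | eventually_fixed f. \<Prod>u\<in>UNIV. if f u = u then x * d u else \<omega> (u, f u))"
    using matrix_forest_theorem[of \<omega> "\<lambda>u. x * d u"] loopless
    by (metis (no_types, lifting) det_diag_matrix det_mul similar)
  also have "\<dots> = (\<Sum>f | eventually_fixed f. choice_weight f * x ^ card {r. f r = r})"
  proof (intro sum.cong refl)
    fix f :: "'v \<Rightarrow> 'v"
    have "(\<Prod>u\<in>UNIV. if f u = u then x * d u else \<omega> (u, f u))
        = (\<Prod>u\<in>UNIV. (if f u = u then d u else \<omega> (u, f u)) * (if f u = u then x else 1))"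
      by (intro prod.cong) auto
    also have "\<dots> = choice_weight f * x ^ card {r. f r = r}"
      by (simp add: prod.distrib choice_weight_def prod.If_cases)
    finally show "(\<Prod>u\<in>UNIV. if f u = u then x * d u else \<omega> (u, f u)) = choice_weight f * x ^ card {r. f r = r}" .
  qed
  finally have "det (mat x + N) = (\<Sum>f | eventually_fixed f. choice_weight f * x ^ card {r. f r = r}) / (\<Prod>u\<in>UNIV. d u)"
    using out_weight_pos by (simp add: field_simps less_imp_neq[symmetric])
  then show ?thesis
    by (simp add: sum_divide_distrib)
qed

text \<open>
  There is always a fixed point, so \<open>x\<close> divides \<open>det (x + N)\<close>, and
  the coefficients of \<open>x\<close> and \<open>x\<^sup>2\<close> come from the functions
  with one and with two fixed points. The product of the degrees cancels.
\<close>
lemma trace_normalized_green: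
  "trace (normalized_green \<omega>) =
    (\<Sum>f | eventually_fixed f \<and> card {r. f r = r} = 2. choice_weight f) /
    (\<Sum>f | eventually_fixed f \<and> card {r. f r = r} = 1. choice_weight f)"
proof -
  let ?D = "\<Prod>u\<in>UNIV. d u"
  have D: "?D \<noteq> 0"
    using out_weight_pos by (simp add: less_imp_neq[symmetric])
  have roots: "card {r. f r = r} = Suc (card {r. f r = r} - 1)" if "eventually_fixed f" for f :: "'v \<Rightarrow> 'v"
  proof -
    have "{r. f r = r} \<noteq> {}"
      using sink_fixed[OF that] by blast
    then have "0 < card {r. f r = r}"
      by (simp only: card_gt_0_iff finite simp_thms)
    then show ?thesis
      by linarith
  qed
  have "trace (normalized_green \<omega>) =
      (\<Sum>f | f \<in> {f. eventually_fixed f} \<and> card {r. f r = r} - 1 = 1. choice_weight f / ?D) /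
      (\<Sum>f | f \<in> {f. eventually_fixed f} \<and> card {r. f r = r} - 1 = 0. choice_weight f / ?D)"
    unfolding normalized_green_def
  proof (rule trace_moore_penrose_inverse_common_kernel[of N kernel_proj])
    fix x :: real
    show "det (mat x + N) = (\<Sum>f | eventually_fixed f. choice_weight f / ?D * x ^ Suc (card {r. f r = r} - 1))"
      unfolding det_normalized_laplacian by (intro sum.cong refl) (simp only: mem_Collect_eq roots[symmetric])
  qed (simp_all add: normalized_laplacian_kernel_proj kernel_proj_normalized_laplacian kernel_proj_idem transpose_kernel_proj trace_kernel_proj
      invertible_normalized_laplacian_plus_kernel_proj)
  moreover have "f \<in> {f. eventually_fixed f} \<and> card {r. f r = r} - 1 = 1 \<longleftrightarrow>
      eventually_fixed f \<and> card {r. f r = r} = 2" for f :: "'v \<Rightarrow> 'v"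
    by auto
  moreover have "f \<in> {f. eventually_fixed f} \<and> card {r. f r = r} - 1 = 0 \<longleftrightarrow>
      eventually_fixed f \<and> card {r. f r = r} = 1" for f :: "'v \<Rightarrow> 'v"
    using roots[of f] by auto
  ultimately show ?thesis
    using D by (simp add: sum_divide_distrib[symmetric])
qed

end

theorem corollary1p6:
  fixes \<Gamma> :: "'v::finite pair_pre_digraph" and \<omega> :: "'v \<times> 'v \<Rightarrow> real"
  assumes "weighted_digraph \<Gamma> \<omega>"
    and "strongly_connected (with_proj \<Gamma>)"
  shows "trace (normalized_green \<omega>) =
    1 / (\<Sum>w\<in>UNIV. out_weight \<omega> w * rooted_tree_weight \<Gamma> \<omega> w) *
    (\<Sum>F\<in>spanning_rooted_forests \<Gamma> 2.
       (\<Prod>T\<in>weak_components F. out_weight \<omega> (root_of T)) * forest_weight \<omega> F)"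
proof -
  interpret strongly_connected_weighted_digraph \<Gamma> \<omega>
    using assms by (simp add: strongly_connected_weighted_digraph_def
        strongly_connected_weighted_digraph_axioms_def)
  show ?thesis
    unfolding rooted_tree_weight_sum[OF assms(1)] sum_spanning_rooted_forests[OF assms(1)]
      trace_normalized_green choice_weight_def by simp
qed

end
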